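(* Let $(M,g,J,\psi_{\mathbb C})$ be a closed, connected nearly Kähler six-manifold with an effective action of the two-torus $T^2$ preserving $g$, $J$ and $\psi_\pm$, let $U,V$ be the generating vector fields of the action, and let $\nu_M\colon M\to\mathbb R$, $\nu_M(p)=\sigma_p(U_p,V_p)$. Let $\Delta$ be the Laplace operator on $C^\infty(M)$, $\Delta=d^*d=-{*}d{*}d$. Then $$\Delta\nu_M=24\,\nu_M .$$
   Context: Let $M$ be a closed (compact, without boundary), connected smooth six-manifold. An $\mathrm{SU}(3)$-structure on $M$ consists of a Riemannian metric $g$, an almost complex structure $J$ which is an isometry of each tangent space, and a complex volume form $\psi_{\mathbb C}=\psi_++i\psi_-$ of type $(3,0)$, with fundamental two-form $\sigma:=g(J\cdot,\cdot)$, such that at each point $p$ there is an orthonormal basis $\{F_k,JF_k\}_{k=1,2,3}$ of $T_pM$, with dual basis $\{f_k,Jf_k\}_{k=1,2,3}$ ($Jf_k$ denoting the element dual to $JF_k$), for which $\sigma=\sum_{k=1}^3 f_k\wedge Jf_k$ and $\psi_{\mathbb C}=(f_1+iJf_1)\wedge(f_2+iJf_2)\wedge(f_3+iJf_3)$. The structure is called nearly Kähler if $$d\sigma=3\psi_+,\qquad d\psi_-=-2\,\sigma\wedge\sigma .$$ The generating vector fields $U,V$ are those of the action induced by a basis of the Lie algebra $\mathfrak t^2$ of $T^2$; in particular $[U,V]=0$. The function $\nu_M=\sigma(U,V)$ is called the multi-moment map; it is $T^2$-invariant and satisfies $d\nu_M=3\psi_+(U,V,\cdot)$. The operator $*$ is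 the Hodge star of $g$, so $\Delta$ is the Laplacian with non-negative spectrum. *)

theory Defs
  imports "HOL-Analysis.Analysis" "HOL-Combinatorics.Permutations"
begin

section \<open>Smooth maps between Euclidean spaces\<close>

text \<open>The following notions are only meant for open sets \<open>S\<close>.\<close>

primrec Ck_on :: "nat \<Rightarrow> ('a::euclidean_space \<Rightarrow> 'b::real_normed_vector) \<Rightarrow> 'a set \<Rightarrow> bool" where
  "Ck_on 0 f S \<longleftrightarrow> continuous_on S f"
| "Ck_on (Suc k) f S \<longleftrightarrow>
     f differentiable_on S \<and> (\<forall>v. Ck_on k (\<lambda>x. frechet_derivative f (at x) v) S)"

definition smooth_on :: "'a set \<Rightarrow> ('a::euclidean_space \<Rightarrow> 'b::real_normed_vector) \<Rightarrow> bool" where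
  "smooth_on S f \<longleftrightarrow> (\<forall>k. Ck_on k f S)"


section \<open>Smooth manifolds\<close>

text \<open>A chart consists of its domain and the coordinate map (irrelevant outside the domain).\<close>

type_synonym ('m, 'e) chart = "'m set \<times> ('m \<Rightarrow> 'e)"

abbreviation cdom :: "('m, 'e) chart \<Rightarrow> 'm set" where "cdom c \<equiv> fst c"
abbreviation cmap :: "('m, 'e) chart \<Rightarrow> 'm \<Rightarrow> 'e" where "cmap c \<equiv> snd c"
abbreviation cimg :: "('m, 'e) chart \<Rightarrow> 'e set" where "cimg c \<equiv> cmap c ` cdom c"
abbreviation cinv :: "('m, 'e) chart \<Rightarrow> 'e \<Rightarrow> 'm" where "cinv c \<equiv> inv_into (cdom c) (cmap c)"

definition is_chart :: "'m topology \<Rightarrow> ('m, 'e::euclidean_space) chart \<Rightarrow> bool" where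
  "is_chart X c \<longleftrightarrow> openin X (cdom c) \<and> open (cimg c) \<and>
     homeomorphic_map (subtopology X (cdom c)) (top_of_set (cimg c)) (cmap c)"

definition smooth_manifold :: "'m topology \<Rightarrow> ('m, 'e::euclidean_space) chart set \<Rightarrow> bool" where
  "smooth_manifold X A \<longleftrightarrow>
     Hausdorff_space X \<and> second_countable X \<and>
     (\<forall>c\<in>A. is_chart X c) \<and> (\<Union>c\<in>A. cdom c) = topspace X \<and>
     (\<forall>c\<in>A. \<forall>d\<in>A. smooth_on (cmap c ` (cdom c \<inter> cdom d)) (cmap d \<circ> cinv c))"

text \<open>
  Some chart around \<open>p\<close>. It is used to evaluate first derivatives at \<open>p\<close>
  in coordinates; by the chain rule (and, for the exterior derivative, the symmetry of second
  derivatives) the notions defined with it do not depend on the choice.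
\<close>

definition chart_at :: "('m, 'e) chart set \<Rightarrow> 'm \<Rightarrow> ('m, 'e) chart" where
  "chart_at A p = (SOME c. c \<in> A \<and> p \<in> cdom c)"


subsection \<open>Tangent vectors\<close>

text \<open>
  A tangent vector at \<open>p\<close> assigns to every chart around \<open>p\<close> its vector of components, subject
  to the usual transformation law; it is \<open>0\<close> on all other arguments.
\<close>

type_synonym ('m, 'e) tangent = "('m, 'e) chart \<Rightarrow> 'e"

definition tangent_space ::
  "('m, 'e::euclidean_space) chart set \<Rightarrow> 'm \<Rightarrow> ('m, 'e) tangent set" where
  "tangent_space A p =
     {v. (\<forall>c\<in>A. \<forall>d\<in>A. p \<in> cdom c \<and> p \<in> cdom d \<longrightarrow>
             v d = frechet_derivative (cmap d \<circ> cinv c) (at (cmap c p)) (v c)) \<and>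
         (\<forall>c. \<not> (c \<in> A \<and> p \<in> cdom c) \<longrightarrow> v c = 0)}"

text \<open>The tangent vector at \<open>p\<close> with components \<open>a\<close> in the chart \<open>c\<close>.\<close>

definition coord_vec ::
  "('m, 'e::euclidean_space) chart set \<Rightarrow> ('m, 'e) chart \<Rightarrow> 'm \<Rightarrow> 'e \<Rightarrow> ('m, 'e) tangent" where
  "coord_vec A c p a =
     (\<lambda>d. if d \<in> A \<and> p \<in> cdom d
          then frechet_derivative (cmap d \<circ> cinv c) (at (cmap c p)) a else 0)"

definition differential ::
  "('m, 'e::euclidean_space) chart set \<Rightarrow> ('m \<Rightarrow> 'm) \<Rightarrow> 'm \<Rightarrow> ('m, 'e) tangent \<Rightarrow> ('m, 'e) tangent"
where
  "differential A f p v =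
     (\<lambda>d. if d \<in> A \<and> f p \<in> cdom d
          then let c = chart_at A p in
            frechet_derivative (cmap d \<circ> f \<circ> cinv c) (at (cmap c p)) (v c)
          else 0)"


section \<open>Differential forms\<close>

text \<open>
  The value of a \<open>k\<close>-form at a point is a function of lists of \<open>k\<close> tangent vectors.
  Its values on lists of another length, or on lists containing elements that are not tangent
  vectors at the point, are irrelevant. Real and complex valued forms are both needed.
\<close>

type_synonym ('m, 'e, 'b) form = "'m \<Rightarrow> ('m, 'e) tangent list \<Rightarrow> 'b"

definition form_in_chart ::
  "('m, 'e::euclidean_space) chart set \<Rightarrow> ('m, 'e) chart \<Rightarrow> ('m, 'e, 'b) form \<Rightarrow> 'e \<Rightarrow> 'e list \<Rightarrow> 'b"
where
  "form_in_chart A c \<omega> x as = \<omega> (cinv c x) (map (coord_vec A c (cinv c x)) as)"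

definition alternating_multilinear ::
  "nat \<Rightarrow> ('a::real_vector list \<Rightarrow> 'b::real_vector) \<Rightarrow> bool" where
  "alternating_multilinear k F \<longleftrightarrow>
     (\<forall>as. length as = k \<longrightarrow>
        (\<forall>i<k. linear (\<lambda>a. F (as[i := a]))) \<and> (\<not> distinct as \<longrightarrow> F as = 0))"

definition smooth_form ::
  "('m, 'e::euclidean_space) chart set \<Rightarrow> nat \<Rightarrow> ('m, 'e, 'b::real_normed_vector) form \<Rightarrow> bool"
where
  "smooth_form A k \<omega> \<longleftrightarrow>
     (\<forall>c\<in>A. (\<forall>x\<in>cimg c. alternating_multilinear k (form_in_chart A c \<omega> x)) \<and>
        (\<forall>as. length as = k \<longrightarrow> smooth_on (cimg c) (\<lambda>x. form_in_chart A c \<omega> x as)))"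

text \<open>
  Normalised such that \<open>(\<alpha> \<and> \<beta>)(v, w) = \<alpha>(v) \<beta>(w) - \<alpha>(w) \<beta>(v)\<close> for one-forms.
\<close>

definition wedge ::
  "nat \<Rightarrow> nat \<Rightarrow> ('v list \<Rightarrow> 'b::real_normed_field) \<Rightarrow> ('v list \<Rightarrow> 'b) \<Rightarrow> 'v list \<Rightarrow> 'b" where
  "wedge k l \<alpha> \<beta> vs =
     (\<Sum>\<pi> | \<pi> permutes {..<k + l}.
        of_int (sign \<pi>) * \<alpha> (map (\<lambda>i. vs ! \<pi> i) [0..<k]) * \<beta> (map (\<lambda>i. vs ! \<pi> i) [k..<k + l]))
     / (fact k * fact l)"

text \<open>
  The coordinate formula for the exterior derivative, i.e. the invariant formula applied to
  coordinate vector fields with constant coefficients (whose brackets vanish). A function is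
  regarded as a zero-form by ignoring its list argument.
\<close>

definition ext_deriv ::
  "('m, 'e::euclidean_space) chart set \<Rightarrow> ('m, 'e, 'b::real_normed_vector) form \<Rightarrow> ('m, 'e, 'b) form"
where
  "ext_deriv A \<omega> p vs =
     (let c = chart_at A p in
        \<Sum>i<length vs. (- 1) ^ i *\<^sub>R
          frechet_derivative
            (\<lambda>x. form_in_chart A c \<omega> x (map (\<lambda>v. v c) (take i vs @ drop (Suc i) vs)))
            (at (cmap c p)) ((vs ! i) c))"


section \<open>Riemannian metrics, almost complex structures, Hodge star\<close>

definition riemannian_metric ::
  "('m, 'e::euclidean_space) chart set \<Rightarrow> ('m \<Rightarrow> ('m, 'e) tangent \<Rightarrow> ('m, 'e) tangent \<Rightarrow> real) \<Rightarrow> bool"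
where
  "riemannian_metric A g \<longleftrightarrow>
     (\<forall>c\<in>A. let h = (\<lambda>x a b. g (cinv c x) (coord_vec A c (cinv c x) a) (coord_vec A c (cinv c x) b))
        in (\<forall>x\<in>cimg c. bilinear (h x) \<and> (\<forall>a b. h x a b = h x b a) \<and> (\<forall>a. a \<noteq> 0 \<longrightarrow> h x a a > 0)) \<and>
           (\<forall>a b. smooth_on (cimg c) (\<lambda>x. h x a b)))"

definition almost_complex_structure ::
  "('m, 'e::euclidean_space) chart set \<Rightarrow> ('m \<Rightarrow> ('m, 'e) tangent \<Rightarrow> ('m, 'e) tangent) \<Rightarrow> bool"
where
  "almost_complex_structure A J \<longleftrightarrow>
     (\<forall>c\<in>A. (\<forall>p\<in>cdom c. \<forall>v\<in>tangent_space A p.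
               J p v \<in> tangent_space A p \<and> J p (J p v) = (\<lambda>d. - v d)) \<and>
        (\<forall>x\<in>cimg c. linear (\<lambda>a. J (cinv c x) (coord_vec A c (cinv c x) a) c)) \<and>
        (\<forall>a. smooth_on (cimg c) (\<lambda>x. J (cinv c x) (coord_vec A c (cinv c x) a) c)))"

definition orthonormal_list :: "('v \<Rightarrow> 'v \<Rightarrow> real) \<Rightarrow> 'v list \<Rightarrow> bool" where
  "orthonormal_list h E \<longleftrightarrow>
     (\<forall>i<length E. \<forall>j<length E. h (E ! i) (E ! j) = (if i = j then 1 else 0))"

text \<open>
  For an orthonormal basis \<open>E\<close> with dual basis \<open>e\<close>, the form \<open>e\<^sub>1 \<and> \<dots> \<and> e\<^sub>n\<close>,
  and the Hodge star for the orientation given by \<open>E\<close>: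
  \<open>*\<beta>\<close> is the sum of \<open>\<beta>(E\<^sub>I) vol(E\<^sub>I, \<dots>)\<close> over increasing multi-indices \<open>I\<close>
  of length \<open>k\<close>. It satisfies \<open>\<alpha> \<and> *\<beta> = \<langle>\<alpha>, \<beta>\<rangle> vol\<close> and depends on \<open>E\<close> only via its orientation.
\<close>

definition frame_vol :: "('v \<Rightarrow> 'v \<Rightarrow> real) \<Rightarrow> 'v list \<Rightarrow> 'v list \<Rightarrow> real" where
  "frame_vol h E vs =
     (\<Sum>\<pi> | \<pi> permutes {..<length E}. of_int (sign \<pi>) * (\<Prod>i<length E. h (E ! i) (vs ! \<pi> i)))"

definition hodge_star ::
  "('v \<Rightarrow> 'v \<Rightarrow> real) \<Rightarrow> 'v list \<Rightarrow> nat \<Rightarrow> ('v list \<Rightarrow> real) \<Rightarrow> 'v list \<Rightarrow> real" where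
  "hodge_star h E k \<beta> ws =
     (\<Sum>I | I \<subseteq> {..<length E} \<and> card I = k. \<beta> (nths E I) * frame_vol h E (nths E I @ ws))"


section \<open>SU(3)-structures and nearly Kaehler six-manifolds\<close>

definition fundamental_form ::
  "('m \<Rightarrow> ('m, 'e) tangent \<Rightarrow> ('m, 'e) tangent \<Rightarrow> real) \<Rightarrow> ('m \<Rightarrow> ('m, 'e) tangent \<Rightarrow> ('m, 'e) tangent)
   \<Rightarrow> ('m, 'e, real) form" where
  "fundamental_form g J p vs = g p (J p (vs ! 0)) (vs ! 1)"

text \<open>
  \<open>E = [F\<^sub>1, J F\<^sub>1, F\<^sub>2, J F\<^sub>2, F\<^sub>3, J F\<^sub>3]\<close> is an orthonormal basis of the (six-dimensional) tangent
  space in which the fundamental form and the complex volume form have their standard shapes.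
  The elements of the dual basis are \<open>g p (E ! i)\<close>.
\<close>

definition su3_frame ::
  "('m, real ^ 6) chart set \<Rightarrow> ('m \<Rightarrow> ('m, real ^ 6) tangent \<Rightarrow> ('m, real ^ 6) tangent \<Rightarrow> real) \<Rightarrow>
   ('m \<Rightarrow> ('m, real ^ 6) tangent \<Rightarrow> ('m, real ^ 6) tangent) \<Rightarrow> ('m, real ^ 6, complex) form \<Rightarrow>
   'm \<Rightarrow> ('m, real ^ 6) tangent list \<Rightarrow> bool" where
  "su3_frame A g J \<psi> p E \<longleftrightarrow>
     length E = 6 \<and> set E \<subseteq> tangent_space A p \<and> orthonormal_list (g p) E \<and>
     (\<forall>k<3. E ! (2 * k + 1) = J p (E ! (2 * k))) \<and>
     (let f = (\<lambda>k vs. g p (E ! (2 * k)) (vs ! 0));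
          Jf = (\<lambda>k vs. g p (E ! (2 * k + 1)) (vs ! 0));
          \<theta> = (\<lambda>k vs. complex_of_real (f k vs) + \<i> * complex_of_real (Jf k vs))
      in (\<forall>u\<in>tangent_space A p. \<forall>v\<in>tangent_space A p.
            fundamental_form g J p [u, v] = (\<Sum>k<3. wedge 1 1 (f k) (Jf k) [u, v])) \<and>
         (\<forall>u\<in>tangent_space A p. \<forall>v\<in>tangent_space A p. \<forall>w\<in>tangent_space A p.
            \<psi> p [u, v, w] = wedge 2 1 (wedge 1 1 (\<theta> 0) (\<theta> 1)) (\<theta> 2) [u, v, w]))"

definition su3_structure ::
  "'m topology \<Rightarrow> ('m, real ^ 6) chart set \<Rightarrow>
   ('m \<Rightarrow> ('m, real ^ 6) tangent \<Rightarrow> ('m, real ^ 6) tangent \<Rightarrow> real) \<Rightarrow>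
   ('m \<Rightarrow> ('m, real ^ 6) tangent \<Rightarrow> ('m, real ^ 6) tangent) \<Rightarrow> ('m, real ^ 6, complex) form \<Rightarrow> bool"
where
  "su3_structure X A g J \<psi> \<longleftrightarrow>
     riemannian_metric A g \<and> almost_complex_structure A J \<and> smooth_form A 3 \<psi> \<and>
     (\<forall>p\<in>topspace X. \<forall>u\<in>tangent_space A p. \<forall>v\<in>tangent_space A p. g p (J p u) (J p v) = g p u v) \<and>
     (\<forall>p\<in>topspace X. \<forall>u\<in>tangent_space A p. \<forall>v\<in>tangent_space A p. \<forall>w\<in>tangent_space A p.
        \<psi> p [J p u, v, w] = \<i> * \<psi> p [u, v, w]) \<and>
     (\<forall>p\<in>topspace X. \<exists>E. su3_frame A g J \<psi> p E)"

definition nearly_kaehler ::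
  "'m topology \<Rightarrow> ('m, real ^ 6) chart set \<Rightarrow>
   ('m \<Rightarrow> ('m, real ^ 6) tangent \<Rightarrow> ('m, real ^ 6) tangent \<Rightarrow> real) \<Rightarrow>
   ('m \<Rightarrow> ('m, real ^ 6) tangent \<Rightarrow> ('m, real ^ 6) tangent) \<Rightarrow> ('m, real ^ 6, complex) form \<Rightarrow> bool"
where
  "nearly_kaehler X A g J \<psi> \<longleftrightarrow>
     su3_structure X A g J \<psi> \<and>
     (\<forall>p\<in>topspace X. \<forall>vs. set vs \<subseteq> tangent_space A p \<longrightarrow>
        (length vs = 3 \<longrightarrow> ext_deriv A (fundamental_form g J) p vs = 3 * Re (\<psi> p vs)) \<and>
        (length vs = 4 \<longrightarrow> ext_deriv A (\<lambda>q ws. Im (\<psi> q ws)) p vs =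
           - 2 * wedge 2 2 (fundamental_form g J p) (fundamental_form g J p) vs))"

text \<open>
  The star of \<open>g\<close> for the orientation of the SU(3)-structure, in which SU(3)-frames are positive.
\<close>

definition su3_star ::
  "('m, real ^ 6) chart set \<Rightarrow> ('m \<Rightarrow> ('m, real ^ 6) tangent \<Rightarrow> ('m, real ^ 6) tangent \<Rightarrow> real) \<Rightarrow>
   ('m \<Rightarrow> ('m, real ^ 6) tangent \<Rightarrow> ('m, real ^ 6) tangent) \<Rightarrow> ('m, real ^ 6, complex) form \<Rightarrow>
   nat \<Rightarrow> ('m, real ^ 6, real) form \<Rightarrow> ('m, real ^ 6, real) form" where
  "su3_star A g J \<psi> k \<beta> p = hodge_star (g p) (SOME E. su3_frame A g J \<psi> p E) k (\<beta> p)"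

text \<open>\<open>- * d * d f\<close>; the outer star maps a six-form to a zero-form.\<close>

definition laplacian ::
  "('m, real ^ 6) chart set \<Rightarrow> ('m \<Rightarrow> ('m, real ^ 6) tangent \<Rightarrow> ('m, real ^ 6) tangent \<Rightarrow> real) \<Rightarrow>
   ('m \<Rightarrow> ('m, real ^ 6) tangent \<Rightarrow> ('m, real ^ 6) tangent) \<Rightarrow> ('m, real ^ 6, complex) form \<Rightarrow>
   ('m \<Rightarrow> real) \<Rightarrow> 'm \<Rightarrow> real" where
  "laplacian A g J \<psi> f p =
     - su3_star A g J \<psi> 6 (ext_deriv A (su3_star A g J \<psi> 1 (ext_deriv A (\<lambda>q _. f q)))) p []"


section \<open>Two-torus actions\<close>

definition torus :: "(complex \<times> complex) set" where
  "torus = sphere 0 1 \<times> sphere 0 1"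

text \<open>The exponential map of the Lie algebra \<open>\<real>\<^sup>2\<close> of the torus.\<close>

definition torus_exp :: "real \<times> real \<Rightarrow> complex \<times> complex" where
  "torus_exp \<xi> = (cis (fst \<xi>), cis (snd \<xi>))"

text \<open>
  Since \<open>torus_exp\<close> is a surjective local diffeomorphism onto the torus, smoothness in the group
  variable may be tested after composing with it.
\<close>

definition smooth_torus_action ::
  "'m topology \<Rightarrow> ('m, 'e::euclidean_space) chart set \<Rightarrow> (complex \<times> complex \<Rightarrow> 'm \<Rightarrow> 'm) \<Rightarrow> bool"
where
  "smooth_torus_action X A act \<longleftrightarrow>
     (\<forall>p\<in>topspace X. act (1, 1) p = p) \<and>
     (\<forall>s\<in>torus. \<forall>t\<in>torus. \<forall>p\<in>topspace X.
        act (fst s * fst t, snd s * snd t) p = act s (act t p)) \<and>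
     continuous_map (prod_topology (top_of_set torus) X) X (\<lambda>(s, p). act s p) \<and>
     (\<forall>c\<in>A. \<forall>d\<in>A.
        smooth_on {(\<tau>, x). x \<in> cimg c \<and> act (torus_exp \<tau>) (cinv c x) \<in> cdom d}
          (\<lambda>(\<tau>, x). cmap d (act (torus_exp \<tau>) (cinv c x))))"

definition effective_torus_action ::
  "'m topology \<Rightarrow> (complex \<times> complex \<Rightarrow> 'm \<Rightarrow> 'm) \<Rightarrow> bool" where
  "effective_torus_action X act \<longleftrightarrow>
     (\<forall>s\<in>torus. (\<forall>p\<in>topspace X. act s p = p) \<longrightarrow> s = (1, 1))"

definition preserves_su3_structure ::
  "'m topology \<Rightarrow> ('m, real ^ 6) chart set \<Rightarrow>
   ('m \<Rightarrow> ('m, real ^ 6) tangent \<Rightarrow> ('m, real ^ 6) tangent \<Rightarrow> real) \<Rightarrow>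
   ('m \<Rightarrow> ('m, real ^ 6) tangent \<Rightarrow> ('m, real ^ 6) tangent) \<Rightarrow> ('m, real ^ 6, complex) form \<Rightarrow>
   (complex \<times> complex \<Rightarrow> 'm \<Rightarrow> 'm) \<Rightarrow> bool" where
  "preserves_su3_structure X A g J \<psi> act \<longleftrightarrow>
     (\<forall>s\<in>torus. \<forall>p\<in>topspace X. \<forall>u\<in>tangent_space A p. \<forall>v\<in>tangent_space A p. \<forall>w\<in>tangent_space A p.
        let D = differential A (act s) p in
          g (act s p) (D u) (D v) = g p u v \<and>
          J (act s p) (D u) = D (J p u) \<and>
          \<psi> (act s p) [D u, D v, D w] = \<psi> p [u, v, w])"

text \<open>The vector field on the manifold generated by an element \<open>\<xi>\<close> of the Lie algebra.\<close>

definition generating_field ::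
  "('m, 'e::euclidean_space) chart set \<Rightarrow> (complex \<times> complex \<Rightarrow> 'm \<Rightarrow> 'm) \<Rightarrow> real \<times> real \<Rightarrow>
   'm \<Rightarrow> ('m, 'e) tangent" where
  "generating_field A act \<xi> p =
     (\<lambda>d. if d \<in> A \<and> p \<in> cdom d
          then vector_derivative (\<lambda>t. cmap d (act (torus_exp (t *\<^sub>R \<xi>)) p)) (at 0) else 0)"

definition multi_moment_map ::
  "('m \<Rightarrow> ('m, 'e) tangent \<Rightarrow> ('m, 'e) tangent \<Rightarrow> real) \<Rightarrow> ('m \<Rightarrow> ('m, 'e) tangent \<Rightarrow> ('m, 'e) tangent) \<Rightarrow>
   ('m \<Rightarrow> ('m, 'e) tangent) \<Rightarrow> ('m \<Rightarrow> ('m, 'e) tangent) \<Rightarrow> 'm \<Rightarrow> real" where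
  "multi_moment_map g J U V p = fundamental_form g J p [U p, V p]"

end

theory Submission
  imports Defs
begin

text \<open>
  Since \<open>U\<close> and \<open>V\<close> commute and preserve \<open>\<sigma>\<close> and \<open>\<psi>\<close>, Cartan's formula gives
  \<open>d\<nu> = d\<sigma>(U, V, \<cdot>) = 3 \<psi>\<^sub>+(U, V, \<cdot>)\<close> and, for \<open>\<beta> = \<psi>\<^sub>-(U, V, \<cdot>)\<close>,
  \<open>d\<beta> = d\<psi>\<^sub>-(U, V, \<cdot>, \<cdot>) = - 2 (\<sigma> \<and> \<sigma>)(U, V, \<cdot>, \<cdot>)\<close>. Because the volume form is
  \<open>\<sigma>\<^sup>3 / 6\<close> and \<open>\<psi>\<close> has type \<open>(3, 0)\<close>, \<open>*d\<nu> = (3/2) \<beta> \<and> \<sigma>\<^sup>2\<close>. As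
  \<open>\<sigma> \<and> d\<sigma> = 3 \<sigma> \<and> \<psi>\<^sub>+ = 0\<close>, it follows that \<open>d*d\<nu> = (3/2) d\<beta> \<and> \<sigma>\<^sup>2 = - 24 \<nu> vol\<close>.

  All of this is computed at one point \<open>q\<close> at a time, in the chart \<open>chart_at A q\<close> in which
  the exterior derivative at \<open>q\<close> is defined, with constant coefficient vectors.
\<close>

section \<open>Symmetry of second derivatives\<close>

lemma second_difference_mean_value:
  fixes f :: "'a::real_normed_vector \<Rightarrow> real"
  assumes h: "0 < h"
    and S: "\<And>s t. \<lbrakk>0 \<le> s; s \<le> h; 0 \<le> t; t \<le> h\<rbrakk> \<Longrightarrow> z + s *\<^sub>R v + t *\<^sub>R w \<in> S"
    and f1: "\<And>x. x \<in> S \<Longrightarrow> (f has_derivative f' x) (at x)"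
    and f2: "\<And>x. x \<in> S \<Longrightarrow> ((\<lambda>x. f' x v) has_derivative f'' x) (at x)"
  shows "\<exists>s t. 0 < s \<and> s < h \<and> 0 < t \<and> t < h \<and>
    f (z + h *\<^sub>R v + h *\<^sub>R w) - f (z + h *\<^sub>R v) - f (z + h *\<^sub>R w) + f z
      = h * h * f'' (z + s *\<^sub>R v + t *\<^sub>R w) w"
proof -
  have d1: "((\<lambda>s. f (z + s *\<^sub>R v + t *\<^sub>R w)) has_real_derivative f' (z + s *\<^sub>R v + t *\<^sub>R w) v) (at s)"
    if "0 \<le> s" "s \<le> h" "0 \<le> t" "t \<le> h" for s t
  proof -
    have "((\<lambda>s. f (z + s *\<^sub>R v + t *\<^sub>R w)) has_derivative
        (\<lambda>k. f' (z + s *\<^sub>R v + t *\<^sub>R w) (k *\<^sub>R v))) (at s)"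
      by (rule has_derivative_compose[where f="\<lambda>s. z + s *\<^sub>R v + t *\<^sub>R w" and g=f,
          OF _ f1[OF S[OF that]]])
        (auto intro!: derivative_eq_intros)
    moreover have "linear (f' (z + s *\<^sub>R v + t *\<^sub>R w))"
      using f1[OF S[OF that]] has_derivative_linear by blast
    ultimately show ?thesis
      by (simp add: has_field_derivative_def linear_cmul mult_commute_abs)
  qed
  have d2: "((\<lambda>t. f' (z + s *\<^sub>R v + t *\<^sub>R w) v) has_real_derivative f'' (z + s *\<^sub>R v + t *\<^sub>R w) w) (at t)"
    if "0 \<le> s" "s \<le> h" "0 \<le> t" "t \<le> h" for s t
  proof -
    have "((\<lambda>t. f' (z + s *\<^sub>R v + t *\<^sub>R w) v) has_derivative
        (\<lambda>k. f'' (z + s *\<^sub>R v + t *\<^sub>R w) (k *\<^sub>R w))) (at t)"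
      by (rule has_derivative_compose[where f="\<lambda>t. z + s *\<^sub>R v + t *\<^sub>R w" and g="\<lambda>x. f' x v",
          OF _ f2[OF S[OF that]]])
        (auto intro!: derivative_eq_intros)
    moreover have "linear (f'' (z + s *\<^sub>R v + t *\<^sub>R w))"
      using f2[OF S[OF that]] has_derivative_linear by blast
    ultimately show ?thesis
      by (simp add: has_field_derivative_def linear_cmul mult_commute_abs)
  qed
  let ?\<phi> = "\<lambda>s. f (z + s *\<^sub>R v + h *\<^sub>R w) - f (z + s *\<^sub>R v)"
  have "(?\<phi> has_real_derivative f' (z + s *\<^sub>R v + h *\<^sub>R w) v - f' (z + s *\<^sub>R v) v) (at s)"
    if "0 \<le> s" "s \<le> h" for s
    using DERIV_diff[OF d1[of s h] d1[of s 0]] that h by simp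
  then obtain s where s: "0 < s" "s < h"
    "?\<phi> h - ?\<phi> 0 = (h - 0) * (f' (z + s *\<^sub>R v + h *\<^sub>R w) v - f' (z + s *\<^sub>R v) v)"
    using MVT2[of 0 h ?\<phi> "\<lambda>s. f' (z + s *\<^sub>R v + h *\<^sub>R w) v - f' (z + s *\<^sub>R v) v"] h by auto
  obtain t where t: "0 < t" "t < h"
    "f' (z + s *\<^sub>R v + h *\<^sub>R w) v - f' (z + s *\<^sub>R v + 0 *\<^sub>R w) v
      = (h - 0) * f'' (z + s *\<^sub>R v + t *\<^sub>R w) w"
    using MVT2[of 0 h "\<lambda>t. f' (z + s *\<^sub>R v + t *\<^sub>R w) v" "\<lambda>t. f'' (z + s *\<^sub>R v + t *\<^sub>R w) w"]
      h s d2[of s] by auto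
  show ?thesis
    using s t by (intro exI[of _ s] exI[of _ t]) (simp add: algebra_simps)
qed

lemma symmetric_second_derivative_real:
  fixes f :: "'a::real_normed_vector \<Rightarrow> real"
  assumes S: "open S" "z \<in> S"
    and f1: "\<And>x. x \<in> S \<Longrightarrow> (f has_derivative f' x) (at x)"
    and fv: "\<And>x. x \<in> S \<Longrightarrow> ((\<lambda>x. f' x v) has_derivative fv x) (at x)"
    and fw: "\<And>x. x \<in> S \<Longrightarrow> ((\<lambda>x. f' x w) has_derivative fw x) (at x)"
    and cont: "continuous_on S (\<lambda>x. fv x w)" "continuous_on S (\<lambda>x. fw x v)"
  shows "fv z w = fw z v"
proof -
  have "\<bar>fv z w - fw z v\<bar> < 2 * e" if e: "0 < e" for e
  proof -
    obtain d1 where d1: "0 < d1" "\<And>x. x \<in> S \<Longrightarrow> dist x z < d1 \<Longrightarrow> dist (fv x w) (fv z w) < e"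
      using cont(1) S(2) e unfolding continuous_on_iff by meson
    obtain d2 where d2: "0 < d2" "\<And>x. x \<in> S \<Longrightarrow> dist x z < d2 \<Longrightarrow> dist (fw x v) (fw z v) < e"
      using cont(2) S(2) e unfolding continuous_on_iff by meson
    obtain d3 where d3: "0 < d3" "ball z d3 \<subseteq> S"
      using S openE by blast
    define d where "d = min d1 (min d2 d3)"
    have d: "0 < d" "d \<le> d1" "d \<le> d2" "d \<le> d3" using d1 d2 d3 by (auto simp: d_def)
    define h where "h = d / (norm v + norm w + 1)"
    have pos: "0 < norm v + norm w + 1" by (smt (verit) norm_ge_zero)
    have h: "0 < h" using d pos by (simp add: h_def)
    have near: "dist (z + s *\<^sub>R v + t *\<^sub>R w) z < d" if "0 \<le> s" "s \<le> h" "0 \<le> t" "t \<le> h" for s t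
    proof -
      have "dist (z + s *\<^sub>R v + t *\<^sub>R w) z \<le> s * norm v + t * norm w"
        using norm_triangle_ineq[of "s *\<^sub>R v" "t *\<^sub>R w"] that by (simp add: dist_norm)
      also have "\<dots> \<le> h * norm v + h * norm w"
        using that by (intro add_mono mult_right_mono) auto
      also have "\<dots> < h * (norm v + norm w + 1)" using h by (simp add: algebra_simps)
      also have "\<dots> = d" using pos by (simp add: h_def)
      finally show ?thesis .
    qed
    have inS: "z + s *\<^sub>R v + t *\<^sub>R w \<in> S" if "0 \<le> s" "s \<le> h" "0 \<le> t" "t \<le> h" for s t
      using near[OF that] d d3 by (auto simp: dist_commute subset_iff)
    obtain s t where st: "0 < s" "s < h" "0 < t" "t < h"
      "f (z + h *\<^sub>R v + h *\<^sub>R w) - f (z + h *\<^sub>R v) - f (z + h *\<^sub>R w) + f z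
      = h * h * fv (z + s *\<^sub>R v + t *\<^sub>R w) w"
      using second_difference_mean_value[of h z v w S f f' fv] h inS f1 fv by blast
    have inS': "z + s *\<^sub>R w + t *\<^sub>R v \<in> S" if "0 \<le> s" "s \<le> h" "0 \<le> t" "t \<le> h" for s t
      using inS[of t s] that by (simp add: add.assoc add.left_commute add.commute)
    obtain t' s' where st': "0 < s'" "s' < h" "0 < t'" "t' < h"
      "f (z + h *\<^sub>R w + h *\<^sub>R v) - f (z + h *\<^sub>R w) - f (z + h *\<^sub>R v) + f z
      = h * h * fw (z + t' *\<^sub>R w + s' *\<^sub>R v) v"
      using second_difference_mean_value[of h z w v S f f' fw] h inS' f1 fw by blast
    have comm: "z + t' *\<^sub>R w + s' *\<^sub>R v = z + s' *\<^sub>R v + t' *\<^sub>R w"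
       "z + h *\<^sub>R w + h *\<^sub>R v = z + h *\<^sub>R v + h *\<^sub>R w" by simp_all
    have "h * h * fv (z + s *\<^sub>R v + t *\<^sub>R w) w = h * h * fw (z + s' *\<^sub>R v + t' *\<^sub>R w) v"
      using st(5) st'(5) unfolding comm by linarith
    then have eq: "fv (z + s *\<^sub>R v + t *\<^sub>R w) w = fw (z + s' *\<^sub>R v + t' *\<^sub>R w) v"
      using h by simp
    have "dist (fv (z + s *\<^sub>R v + t *\<^sub>R w) w) (fv z w) < e"
      using st d near[of s t] by (intro d1(2) inS) auto
    moreover have "dist (fw (z + s' *\<^sub>R v + t' *\<^sub>R w) v) (fw z v) < e"
      using st' d near[of s' t'] by (intro d2(2) inS) auto
    ultimately show ?thesis using eq by (simp add: dist_real_def)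
  qed
  from this[of "\<bar>fv z w - fw z v\<bar> / 2"] show ?thesis
    by (cases "fv z w = fw z v") auto
qed

lemma symmetric_second_derivative:
  fixes f :: "'a::real_normed_vector \<Rightarrow> 'b::real_inner"
  assumes S: "open S" "z \<in> S"
    and f1: "\<And>x. x \<in> S \<Longrightarrow> (f has_derivative f' x) (at x)"
    and fv: "\<And>x. x \<in> S \<Longrightarrow> ((\<lambda>x. f' x v) has_derivative fv x) (at x)"
    and fw: "\<And>x. x \<in> S \<Longrightarrow> ((\<lambda>x. f' x w) has_derivative fw x) (at x)"
    and cont: "continuous_on S (\<lambda>x. fv x w)" "continuous_on S (\<lambda>x. fw x v)"
  shows "fv z w = fw z v"
proof -
  have "fv z w \<bullet> c = fw z v \<bullet> c" for c
    by (rule symmetric_second_derivative_real[OF S, of "\<lambda>x. f x \<bullet> c" "\<lambda>x h. f' x h \<bullet> c" v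
          "\<lambda>x h. fv x h \<bullet> c" w "\<lambda>x h. fw x h \<bullet> c"])
      (auto intro!: has_derivative_inner_left f1 fv fw continuous_intros cont)
  then show ?thesis
    by (metis inner_diff_left inner_eq_zero_iff right_minus_eq)
qed

lemma smooth_on_imp_differentiable:
  assumes "smooth_on S f" "open S" "x \<in> S"
  shows "f differentiable at x"
proof -
  have "Ck_on (Suc 0) f S" using assms by (simp add: smooth_on_def)
  then have "f differentiable (at x within S)" using assms by (auto simp: differentiable_on_def)
  then show ?thesis using assms at_within_open by metis
qed

lemma smooth_on_frechet_derivative:
  "smooth_on S f \<Longrightarrow> smooth_on S (\<lambda>x. frechet_derivative f (at x) v)"
  unfolding smooth_on_def by (metis Ck_on.simps(2))

lemma smooth_on_imp_continuous_on: "smooth_on S f \<Longrightarrow> continuous_on S f"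
  unfolding smooth_on_def by (metis Ck_on.simps(1))

lemma smooth_on_symmetric_derivative:
  fixes f :: "'a::euclidean_space \<Rightarrow> 'b::real_inner"
  assumes "smooth_on S f" "open S" "z \<in> S"
  shows "frechet_derivative (\<lambda>x. frechet_derivative f (at x) v) (at z) w =
         frechet_derivative (\<lambda>x. frechet_derivative f (at x) w) (at z) v"
  by (rule symmetric_second_derivative[OF assms(2,3), of f "\<lambda>x. frechet_derivative f (at x)"])
    (auto intro!: smooth_on_imp_differentiable[OF _ assms(2)] smooth_on_frechet_derivative
       smooth_on_imp_continuous_on assms simp: frechet_derivative_works[symmetric])

lemma has_derivative_linear_family:
  fixes f :: "'a::real_normed_vector \<Rightarrow> 'b::euclidean_space"
    and q :: "'a \<Rightarrow> 'b \<Rightarrow> 'c::real_normed_vector"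
  assumes lin: "\<forall>\<^sub>F x in nhds x0. linear (q x)"
    and q': "\<And>a. ((\<lambda>x. q x a) has_derivative (\<lambda>h. q' h a)) (at x0)"
    and f': "(f has_derivative f') (at x0)"
  shows "((\<lambda>x. q x (f x)) has_derivative (\<lambda>h. q' h (f x0) + q x0 (f' h))) (at x0)"
proof -
  obtain T where T: "open T" "x0 \<in> T" "\<And>x. x \<in> T \<Longrightarrow> linear (q x)"
    using lin by (auto simp: eventually_nhds)
  have exp: "q x a = (\<Sum>i\<in>Basis. (a \<bullet> i) *\<^sub>R q x i)" if "x \<in> T" for x a
    using linear_sum[OF T(3)[OF that], of "\<lambda>i. (a \<bullet> i) *\<^sub>R i" Basis]
    by (simp add: euclidean_representation linear_cmul[OF T(3)[OF that]])
  have lin': "linear (q' h)" for h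
  proof (rule linearI)
    fix a b
    have "((\<lambda>x. q x (a + b)) has_derivative (\<lambda>h. q' h a + q' h b)) (at x0)"
      by (rule has_derivative_transform_within_open[OF has_derivative_add[OF q'[of a] q'[of b]] T(1,2)])
        (simp add: T(3) linear_add)
    from has_derivative_unique[OF this q'[of "a + b"]] show "q' h (a + b) = q' h a + q' h b"
      by metis
  next
    fix r a
    have "((\<lambda>x. q x (r *\<^sub>R a)) has_derivative (\<lambda>h. r *\<^sub>R q' h a)) (at x0)"
      by (rule has_derivative_transform_within_open[OF has_derivative_scaleR_right[OF q'[of a]] T(1,2)])
        (simp add: T(3) linear_cmul)
    from has_derivative_unique[OF this q'[of "r *\<^sub>R a"]] show "q' h (r *\<^sub>R a) = r *\<^sub>R q' h a"
      by metis
  qed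
  have "((\<lambda>x. \<Sum>i\<in>Basis. (f x \<bullet> i) *\<^sub>R q x i) has_derivative
      (\<lambda>h. \<Sum>i\<in>Basis. (f x0 \<bullet> i) *\<^sub>R q' h i + (f' h \<bullet> i) *\<^sub>R q x0 i)) (at x0)"
    by (intro has_derivative_sum has_derivative_scaleR has_derivative_inner_left f' q')
  also have "(\<lambda>h. \<Sum>i\<in>Basis. (f x0 \<bullet> i) *\<^sub>R q' h i + (f' h \<bullet> i) *\<^sub>R q x0 i) =
      (\<lambda>h. q' h (f x0) + q x0 (f' h))"
  proof
    fix h
    have "q' h (f x0) = (\<Sum>i\<in>Basis. (f x0 \<bullet> i) *\<^sub>R q' h i)"
      using linear_sum[OF lin', of h "\<lambda>i. (f x0 \<bullet> i) *\<^sub>R i" Basis]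
      by (simp add: euclidean_representation linear_cmul[OF lin'])
    then show "(\<Sum>i\<in>Basis. (f x0 \<bullet> i) *\<^sub>R q' h i + (f' h \<bullet> i) *\<^sub>R q x0 i) = q' h (f x0) + q x0 (f' h)"
      using exp[OF T(2), of "f' h"] by (simp add: sum.distrib)
  qed
  finally show ?thesis
    by (rule has_derivative_transform_within_open[OF _ T(1,2)]) (simp add: exp)
qed

section \<open>Alternating functions and the Pfaffian\<close>

lemma multilinear_expansion:
  fixes F :: "(nat \<Rightarrow> 'v::real_vector) \<Rightarrow> real"
  assumes lin: "\<And>w i. i < n \<Longrightarrow> linear (\<lambda>a. F (w(i := a)))"
    and "finite T" "T \<subseteq> {..<n}" "finite S"
  shows "F (\<lambda>i. if i \<in> T then \<Sum>j\<in>S. m i j *\<^sub>R e j else c i) =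
    (\<Sum>f | (\<forall>i\<in>T. f i \<in> S) \<and> (\<forall>i. i \<notin> T \<longrightarrow> f i = i).
       (\<Prod>i\<in>T. m i (f i)) * F (\<lambda>i. if i \<in> T then e (f i) else c i))"
  using assms(2,3)
proof (induction T arbitrary: c rule: finite_induct)
  case empty
  have "{f::nat \<Rightarrow> nat. \<forall>i. f i = i} = {id}" by auto
  then show ?case by simp
next
  case (insert z T)
  let ?P = "\<lambda>T. {f::nat \<Rightarrow> nat. (\<forall>i\<in>T. f i \<in> S) \<and> (\<forall>i. i \<notin> T \<longrightarrow> f i = i)}"
  let ?w = "\<lambda>i. if i \<in> T then \<Sum>j\<in>S. m i j *\<^sub>R e j else c i"
  have z: "z < n" "z \<notin> T" using insert by auto
  have "F (\<lambda>i. if i \<in> insert z T then \<Sum>j\<in>S. m i j *\<^sub>R e j else c i) =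
      F (?w(z := \<Sum>j\<in>S. m z j *\<^sub>R e j))"
    using z by (intro arg_cong[where f=F]) auto
  also have "\<dots> = (\<Sum>j\<in>S. m z j * F (?w(z := e j)))"
    using linear_sum[OF lin[OF z(1)], of ?w "\<lambda>j. m z j *\<^sub>R e j" S]
    by (simp add: linear_cmul[OF lin[OF z(1)]])
  also have "\<dots> = (\<Sum>j\<in>S. m z j * F (\<lambda>i. if i \<in> T then \<Sum>j\<in>S. m i j *\<^sub>R e j else (c(z := e j)) i))"
    using z by (intro sum.cong refl arg_cong2[where f="(*)"] arg_cong[where f=F]) auto
  also have "\<dots> = (\<Sum>j\<in>S. \<Sum>f\<in>?P T. m z j * ((\<Prod>i\<in>T. m i (f i)) *
      F (\<lambda>i. if i \<in> T then e (f i) else (c(z := e j)) i)))"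
    using insert by (simp add: sum_distrib_left)
  also have "\<dots> = (\<Sum>(j, f)\<in>S \<times> ?P T. m z j * ((\<Prod>i\<in>T. m i (f i)) *
      F (\<lambda>i. if i \<in> T then e (f i) else (c(z := e j)) i)))"
    by (simp add: sum.cartesian_product)
  also have "\<dots> = (\<Sum>f\<in>?P (insert z T). (\<Prod>i\<in>insert z T. m i (f i)) *
      F (\<lambda>i. if i \<in> insert z T then e (f i) else c i))"
  proof (rule sum.reindex_bij_witness[where i="\<lambda>f. (f z, f(z := z))" and j="\<lambda>(j, f). f(z := j)"])
    fix a assume a: "a \<in> S \<times> ?P T"
    obtain j f where jf: "a = (j, f)" by (cases a)
    have "(\<Prod>i\<in>insert z T. m i ((f(z := j)) i)) = m z j * (\<Prod>i\<in>T. m i ((f(z := j)) i))"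
      using insert by simp
    also have "(\<Prod>i\<in>T. m i ((f(z := j)) i)) = (\<Prod>i\<in>T. m i (f i))"
      using z by (intro prod.cong) auto
    finally have p: "(\<Prod>i\<in>insert z T. m i ((f(z := j)) i)) = m z j * (\<Prod>i\<in>T. m i (f i))" .
    have q: "(\<lambda>i. if i \<in> insert z T then e ((f(z := j)) i) else c i) =
        (\<lambda>i. if i \<in> T then e (f i) else (c(z := e j)) i)"
      using z by auto
    show "(\<Prod>i\<in>insert z T. m i ((case a of (j, f) \<Rightarrow> f(z := j)) i)) *
         F (\<lambda>i. if i \<in> insert z T then e ((case a of (j, f) \<Rightarrow> f(z := j)) i) else c i) =
         (case a of (j, f) \<Rightarrow> m z j * ((\<Prod>i\<in>T. m i (f i)) *
           F (\<lambda>i. if i \<in> T then e (f i) else (c(z := e j)) i)))"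
      unfolding jf prod.case p q by simp
  qed (use z in \<open>auto split: if_splits\<close>)
  finally show ?case .
qed

lemma alternating_transpose:
  fixes F :: "(nat \<Rightarrow> 'v::real_vector) \<Rightarrow> real"
  assumes lin: "\<And>w i. i < n \<Longrightarrow> linear (\<lambda>a. F (w(i := a)))"
    and alt: "\<And>w i j. \<lbrakk>i < n; j < n; i \<noteq> j; w i = w j\<rbrakk> \<Longrightarrow> F w = 0"
    and ij: "i < n" "j < n" "i \<noteq> j"
  shows "F (w \<circ> Transposition.transpose i j) = - F w"
proof -
  let ?G = "\<lambda>a b. F ((w(i := a))(j := b))"
  have swap: "(w(i := a))(j := b) = (w(j := b))(i := a)" for a b using ij by auto
  have add1: "?G (a + a') b = ?G a b + ?G a' b" for a a' b
    unfolding swap by (rule linear_add[OF lin[OF ij(1)]])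
  have add2: "?G a (b + b') = ?G a b + ?G a b'" for a b b'
    by (rule linear_add[OF lin[OF ij(2)]])
  have zero: "?G a a = 0" for a
    by (rule alt[OF ij]) (use ij in auto)
  have "0 = ?G (w i + w j) (w i + w j)" using zero by simp
  also have "\<dots> = ?G (w i) (w j) + ?G (w j) (w i)"
    unfolding add1 add2 by (simp add: zero del: fun_upd_apply fun_upd_triv)
  finally have "?G (w j) (w i) = - ?G (w i) (w j)" by simp
  moreover have "(w(i := w j))(j := w i) = w \<circ> Transposition.transpose i j"
    using ij by (auto simp: fun_eq_iff transpose_def)
  moreover have "(w(i := w i))(j := w j) = w" by auto
  ultimately show ?thesis by (simp del: fun_upd_apply)
qed

lemma alternating_permute:
  fixes F :: "(nat \<Rightarrow> 'v::real_vector) \<Rightarrow> real"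
  assumes lin: "\<And>w i. i < n \<Longrightarrow> linear (\<lambda>a. F (w(i := a)))"
    and alt: "\<And>w i j. \<lbrakk>i < n; j < n; i \<noteq> j; w i = w j\<rbrakk> \<Longrightarrow> F w = 0"
    and p: "p permutes {..<n}"
  shows "F (w \<circ> p) = of_int (sign p) * F w"
proof -
  have "finite {..<n}" by simp
  from this p show ?thesis
  proof (induction rule: permutes_rev_induct)
    case id
    show ?case by simp
  next
    case (swap a b p)
    have "F (w \<circ> (p \<circ> Transposition.transpose a b)) = - F (w \<circ> p)"
      unfolding o_assoc
    proof (rule alternating_transpose[where n=n])
      show "a < n" "b < n" "a \<noteq> b" using swap by auto
    qed (blast intro: lin alt)+
    also have "\<dots> = of_int (sign (p \<circ> Transposition.transpose a b)) * F w"
      unfolding swap.IH using swap.hyps permutes_imp_permutation[of "{..<n}" p]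
      by (simp add: sign_compose permutation_swap_id sign_swap_id)
    finally show ?case .
  qed
qed

lemma alternating_eq_det:
  fixes F :: "(nat \<Rightarrow> 'v::real_vector) \<Rightarrow> real"
  assumes lin: "\<And>w i. i < n \<Longrightarrow> linear (\<lambda>a. F (w(i := a)))"
    and alt: "\<And>w i j. \<lbrakk>i < n; j < n; i \<noteq> j; w i = w j\<rbrakk> \<Longrightarrow> F w = 0"
    and dep: "\<And>w w'. (\<And>i. i < n \<Longrightarrow> w i = w' i) \<Longrightarrow> F w = F w'"
    and w: "\<And>i. i < n \<Longrightarrow> w i = (\<Sum>j<n. m j i *\<^sub>R e j)"
  shows "F w = (\<Sum>\<pi> | \<pi> permutes {..<n}. of_int (sign \<pi>) * (\<Prod>i<n. m i (\<pi> i))) * F e"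
proof -
  let ?A = "{f::nat \<Rightarrow> nat. (\<forall>i\<in>{..<n}. f i \<in> {..<n}) \<and> (\<forall>i. i \<notin> {..<n} \<longrightarrow> f i = i)}"
  let ?Q = "{\<pi>. \<pi> permutes {..<n}}"
  have "F w = F (\<lambda>i. if i \<in> {..<n} then \<Sum>j\<in>{..<n}. m j i *\<^sub>R e j else e i)"
    using w by (intro dep) auto
  also have "\<dots> = (\<Sum>f\<in>?A. (\<Prod>i<n. m (f i) i) * F (\<lambda>i. if i \<in> {..<n} then e (f i) else e i))"
    by (rule multilinear_expansion[OF lin]) auto
  also have "\<dots> = (\<Sum>f\<in>?A. (\<Prod>i<n. m (f i) i) * F (e \<circ> f))"
    by (intro sum.cong refl arg_cong2[where f="(*)"] dep) auto
  also have "\<dots> = (\<Sum>f\<in>?Q. (\<Prod>i<n. m (f i) i) * F (e \<circ> f))"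
  proof (rule sum.mono_neutral_right)
    have "?A \<subseteq> (\<lambda>f i. if i < n then f i else i) ` ({..<n} \<rightarrow>\<^sub>E {..<n})"
    proof
      fix f assume "f \<in> ?A"
      then have "f = (\<lambda>i. if i < n then restrict f {..<n} i else i)" "restrict f {..<n} \<in> {..<n} \<rightarrow>\<^sub>E {..<n}"
        by auto
      then show "f \<in> (\<lambda>f i. if i < n then f i else i) ` ({..<n} \<rightarrow>\<^sub>E {..<n})" by blast
    qed
    then show "finite ?A" by (rule finite_subset) (auto intro: finite_PiE)
    show "?Q \<subseteq> ?A" by (auto dest: permutes_in_image permutes_not_in)
    show "\<forall>f\<in>?A - ?Q. (\<Prod>i<n. m (f i) i) * F (e \<circ> f) = 0"
    proof
      fix f assume f: "f \<in> ?A - ?Q"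
      have "\<not> inj_on f {..<n}"
      proof
        assume "inj_on f {..<n}"
        moreover from this have "f ` {..<n} = {..<n}"
          using f by (intro endo_inj_surj) auto
        ultimately have "bij_betw f {..<n} {..<n}" by (rule bij_betw_imageI)
        then have "f permutes {..<n}" using f by (intro bij_imp_permutes) auto
        then show False using f by simp
      qed
      then obtain i j where "i < n" "j < n" "i \<noteq> j" "f i = f j"
        by (auto simp: inj_on_def)
      then have "F (e \<circ> f) = 0" by (intro alt[of i j]) auto
      then show "(\<Prod>i<n. m (f i) i) * F (e \<circ> f) = 0" by simp
    qed
  qed
  also have "\<dots> = (\<Sum>f\<in>?Q. of_int (sign f) * (\<Prod>i<n. m (f i) i) * F e)"
  proof (intro sum.cong refl)
    fix f assume "f \<in> ?Q"
    then have f: "f permutes {..<n}" by simp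
    have "F (e \<circ> f) = of_int (sign f) * F e"
    proof (rule alternating_permute[where n=n])
      show "f permutes {..<n}" by (fact f)
    qed (blast intro: lin alt)+
    then show "(\<Prod>i<n. m (f i) i) * F (e \<circ> f) = of_int (sign f) * (\<Prod>i<n. m (f i) i) * F e"
      by simp
  qed
  also have "\<dots> = (\<Sum>f\<in>?Q. of_int (sign (inv f)) * (\<Prod>i<n. m (inv f i) i) * F e)"
    by (rule sum_permutations_inverse)
  also have "\<dots> = (\<Sum>f\<in>?Q. of_int (sign f) * (\<Prod>i<n. m i (f i)) * F e)"
  proof (intro sum.cong refl arg_cong2[where f="(*)"])
    fix f assume "f \<in> ?Q"
    then have f: "f permutes {..<n}" by simp
    show "real_of_int (sign (inv f)) = real_of_int (sign f)"
      using permutes_imp_permutation[OF _ f] by (simp add: sign_inverse)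
    show "(\<Prod>i<n. m (inv f i) i) = (\<Prod>i<n. m i (f i))"
      using prod.permute[OF f, of "\<lambda>i. m (inv f i) i"] permutes_inverses[OF f] by (simp add: o_def)
  qed
  finally show ?thesis by (simp add: sum_distrib_right)
qed

definition pfaffian4 :: "(nat \<Rightarrow> nat \<Rightarrow> real) \<Rightarrow> nat \<Rightarrow> nat \<Rightarrow> nat \<Rightarrow> nat \<Rightarrow> real" where
  "pfaffian4 s a b c d = s a b * s c d - s a c * s b d + s a d * s b c"

definition pfaffian6 :: "(nat \<Rightarrow> nat \<Rightarrow> real) \<Rightarrow> real" where
  "pfaffian6 s = s 0 1 * pfaffian4 s 2 3 4 5 - s 0 2 * pfaffian4 s 1 3 4 5
     + s 0 3 * pfaffian4 s 1 2 4 5 - s 0 4 * pfaffian4 s 1 2 3 5 + s 0 5 * pfaffian4 s 1 2 3 4"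

lemma less_6_cases: "i < 6 \<Longrightarrow> i \<in> {0, 1, 2, 3, 4, 5::nat}"
  by auto

lemma pfaffian6_degenerate:
  assumes skew: "\<And>i j. s j i = - s i j"
    and ij: "i < 6" "j < 6" "i \<noteq> j" "\<And>k. s i k = s j k"
  shows "pfaffian6 s = 0"
proof -
  have diag: "s k k = 0" for k using skew[of k k] by simp
  have rev: "s (Suc 0) 0 = - s 0 (Suc 0)"
    "s 2 0 = - s 0 2"
    "s 3 0 = - s 0 3"
    "s 4 0 = - s 0 4"
    "s 5 0 = - s 0 5"
    "s 2 (Suc 0) = - s (Suc 0) 2"
    "s 3 (Suc 0) = - s (Suc 0) 3"
    "s 4 (Suc 0) = - s (Suc 0) 4"
    "s 5 (Suc 0) = - s (Suc 0) 5"
    "s 3 2 = - s 2 3"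
    "s 4 2 = - s 2 4"
    "s 5 2 = - s 2 5"
    "s 4 3 = - s 3 4"
    "s 5 3 = - s 3 5"
    "s 5 4 = - s 4 5"
    by (rule skew)+
  have *: "pfaffian6 s = 0" if "i < j" "i < 6" "j < 6" "\<And>k. s i k = s j k" for i j
  proof -
    have eq: "s i 0 = s j 0" "s i 1 = s j 1" "s i 2 = s j 2" "s i 3 = s j 3" "s i 4 = s j 4" "s i 5 = s j 5"
      using that(4) by auto
    show ?thesis
      using less_6_cases[OF that(2)] less_6_cases[OF that(3)] that(1) eq
      by (elim insertE emptyE) (simp_all add: diag rev pfaffian6_def pfaffian4_def algebra_simps)
  qed
  show ?thesis using *[of i j] *[of j i] ij by (cases "i < j") auto
qed

lemma pfaffian6_eq_det:
  fixes \<sigma> :: "'v::real_vector \<Rightarrow> 'v \<Rightarrow> real"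
  assumes bil: "bilinear \<sigma>" and skew: "\<And>a b. \<sigma> b a = - \<sigma> a b"
    and w: "\<And>i. i < 6 \<Longrightarrow> w i = (\<Sum>j<6. m j i *\<^sub>R e j)"
  shows "pfaffian6 (\<lambda>i j. \<sigma> (w i) (w j)) =
    (\<Sum>\<pi> | \<pi> permutes {..<6}. of_int (sign \<pi>) * (\<Prod>i<6. m i (\<pi> i))) *
    pfaffian6 (\<lambda>i j. \<sigma> (e i) (e j))"
proof (rule alternating_eq_det[where F="\<lambda>w. pfaffian6 (\<lambda>i j. \<sigma> (w i) (w j))" and n=6])
  fix w :: "nat \<Rightarrow> 'v" and i :: nat
  assume "i < 6"
  show "linear (\<lambda>a. pfaffian6 (\<lambda>k j. \<sigma> ((w(i := a)) k) ((w(i := a)) j)))"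
    using less_6_cases[OF \<open>i < 6\<close>]
    by (elim insertE emptyE; intro linearI)
      (simp_all add: pfaffian6_def pfaffian4_def bilinear_ladd[OF bil] bilinear_radd[OF bil]
        bilinear_lmul[OF bil] bilinear_rmul[OF bil] algebra_simps)
next
  fix w :: "nat \<Rightarrow> 'v" and i j :: nat
  assume "i < 6" "j < 6" "i \<noteq> j" "w i = w j"
  then show "pfaffian6 (\<lambda>i j. \<sigma> (w i) (w j)) = 0"
    by (intro pfaffian6_degenerate[of _ i j]) (auto intro: skew)
next
  fix w w' :: "nat \<Rightarrow> 'v"
  assume "\<And>i. i < 6 \<Longrightarrow> w i = w' i"
  then show "pfaffian6 (\<lambda>i j. \<sigma> (w i) (w j)) = pfaffian6 (\<lambda>i j. \<sigma> (w' i) (w' j))"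
    by (simp add: pfaffian6_def pfaffian4_def)
qed (rule w)

lemma wedge_1_1:
  "wedge 1 1 \<alpha> \<beta> [u, v] = \<alpha> [u] * \<beta> [v] - \<alpha> [v] * \<beta> [u]"
proof -
  have S: "{..<1 + 1} = insert 0 {1::nat}" by auto
  have U: "[0..<1] = [0::nat]" "[1..<1 + 1] = [1::nat]" by (simp_all add: upt_rec)
  show ?thesis
    unfolding wedge_def S U
    by (subst sum_over_permutations_insert)
      (auto simp: permutes_sing sign_swap_id transpose_def sign_id)
qed

lemma wedge_2_2:
  "wedge 2 2 \<sigma> \<sigma> [a, b, c, d] =
    (let s = (\<lambda>x y. \<sigma> [x, y]) in
     ((s a b - s b a) * (s c d - s d c) - (s a c - s c a) * (s b d - s d b)
      + (s a d - s d a) * (s b c - s c b)) / 2)"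
proof -
  have S: "{..<2 + 2} = insert 0 (insert 1 (insert 2 {3::nat}))" by auto
  have U: "[0..<2] = [0, 1::nat]" "[2..<2 + 2] = [2, 3::nat]" by (simp_all add: upt_rec)
  have f: "finite {1, 2, 3::nat}" "0 \<notin> {1, 2, 3::nat}" "finite {2, 3::nat}" "1 \<notin> {2, 3::nat}"
    "finite {3::nat}" "2 \<notin> {3::nat}" by auto
  show ?thesis
    unfolding wedge_def S U
    unfolding sum_over_permutations_insert[OF f(1,2)] sum_over_permutations_insert[OF f(3,4)]
      sum_over_permutations_insert[OF f(5,6)]
      permutes_sing
    by (simp add: sign_swap_id permutation_swap_id sign_compose sign_id permutation_compose transpose_def Let_def
        fact_numeral field_simps)
qed

section \<open>Linear algebra of an SU(3)-frame\<close>

lemma sum_lessThan_3: "(\<Sum>j<3. f j) = f 0 + f (Suc 0) + f (2::nat)" for f :: "nat \<Rightarrow> 'a::comm_monoid_add"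
  by (simp add: eval_nat_numeral)

lemma sum_lessThan_6: "(\<Sum>j<6. f j) = f 0 + f (Suc 0) + f 2 + f 3 + f 4 + f (5::nat)"
  for f :: "nat \<Rightarrow> 'a::comm_monoid_add"
  by (simp add: eval_nat_numeral)

locale hermitian_frame =
  fixes h :: "'v::real_vector \<Rightarrow> 'v \<Rightarrow> real" and J :: "'v \<Rightarrow> 'v" and e :: "nat \<Rightarrow> 'v"
  assumes bil: "bilinear h"
    and pos: "a \<noteq> 0 \<Longrightarrow> h a a > 0"
    and J_linear: "linear J"
    and J_J: "J (J a) = - a"
    and ortho: "\<lbrakk>i < 6; j < 6\<rbrakk> \<Longrightarrow> h (e i) (e j) = (if i = j then 1 else 0)"
    and J_e: "k < 3 \<Longrightarrow> J (e (2 * k)) = e (2 * k + 1)"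
    and std: "h (J a) b = (\<Sum>k<3. h (e (2 * k)) a * h (e (2 * k + 1)) b - h (e (2 * k)) b * h (e (2 * k + 1)) a)"
begin

definition \<sigma> :: "'v \<Rightarrow> 'v \<Rightarrow> real" where "\<sigma> a b = h (J a) b"

lemma \<sigma>_bilinear: "bilinear \<sigma>"
  unfolding \<sigma>_def bilinear_def
proof (intro conjI allI linearI)
  fix x a b :: 'v and r :: real
  show "h (J x) (a + b) = h (J x) a + h (J x) b" by (rule bilinear_radd[OF bil])
  show "h (J x) (r *\<^sub>R a) = r *\<^sub>R h (J x) a" by (rule bilinear_rmul[OF bil])
  show "h (J (a + b)) x = h (J a) x + h (J b) x"
    by (simp add: linear_add[OF J_linear] bilinear_ladd[OF bil])
  show "h (J (r *\<^sub>R a)) x = r *\<^sub>R h (J a) x"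
    by (simp add: linear_cmul[OF J_linear] bilinear_lmul[OF bil])
qed

lemma \<sigma>_expand:
  "\<sigma> a b = h (e 0) a * h (e (Suc 0)) b - h (e 0) b * h (e (Suc 0)) a
     + (h (e 2) a * h (e 3) b - h (e 2) b * h (e 3) a)
     + (h (e 4) a * h (e 5) b - h (e 4) b * h (e 5) a)"
  unfolding \<sigma>_def std by (simp add: sum_lessThan_3)

lemma \<sigma>_skew: "\<sigma> b a = - \<sigma> a b"
  unfolding \<sigma>_expand by (simp add: algebra_simps)

lemma J_e_values:
  "J (e 0) = e (Suc 0)" "J (e 2) = e 3" "J (e 4) = e 5"
  "J (e (Suc 0)) = - e 0" "J (e 3) = - e 2" "J (e 5) = - e 4"
  using J_e[of 0] J_e[of 1] J_e[of 2] J_J[of "e 0"] J_J[of "e 2"] J_J[of "e 4"]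
  by simp_all

lemma \<sigma>_e_left:
  "\<sigma> (e 0) b = h (e (Suc 0)) b" "\<sigma> (e 2) b = h (e 3) b" "\<sigma> (e 4) b = h (e 5) b"
  "\<sigma> (e (Suc 0)) b = - h (e 0) b" "\<sigma> (e 3) b = - h (e 2) b" "\<sigma> (e 5) b = - h (e 4) b"
  by (simp_all only: \<sigma>_def J_e_values bilinear_lneg[OF bil])

lemma \<sigma>_e_right:
  "\<sigma> b (e 0) = - h (e (Suc 0)) b" "\<sigma> b (e 2) = - h (e 3) b" "\<sigma> b (e 4) = - h (e 5) b"
  "\<sigma> b (e (Suc 0)) = h (e 0) b" "\<sigma> b (e 3) = h (e 2) b" "\<sigma> b (e 5) = h (e 4) b"
  by (simp_all only: \<sigma>_skew[of b] \<sigma>_e_left minus_minus)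

lemma expansion: "w = (\<Sum>j<6. h (e j) w *\<^sub>R e j)"
proof -
  define d where "d = w - (\<Sum>j<6. h (e j) w *\<^sub>R e j)"
  have "h (e i) d = 0" if "i < 6" for i
  proof -
    have "h (e i) (\<Sum>j<6. h (e j) w *\<^sub>R e j) = (\<Sum>j<6. h (e j) w * h (e i) (e j))"
      using linear_sum[of "h (e i)" "\<lambda>j. h (e j) w *\<^sub>R e j" "{..<6}"] bil
      by (simp add: bilinear_def linear_cmul)
    also have "\<dots> = (\<Sum>j<6. if j = i then h (e i) w else 0)"
      using that by (intro sum.cong) (auto simp: ortho)
    finally show ?thesis using that by (simp add: d_def bilinear_rsub[OF bil])
  qed
  then have "h (J (J d)) d = 0"
    unfolding \<sigma>_def[symmetric] \<sigma>_expand by simp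
  then have "h d d = 0" by (simp add: J_J bilinear_lneg[OF bil])
  then have "d = 0" using pos[of d] by auto
  then show ?thesis by (simp add: d_def)
qed

lemma pfaffian6_frame: "pfaffian6 (\<lambda>i j. \<sigma> (e i) (e j)) = 1"
  by (simp add: pfaffian6_def pfaffian4_def \<sigma>_e_left ortho)

lemma det_eq_pfaffian6:
  "(\<Sum>\<pi> | \<pi> permutes {..<6}. of_int (sign \<pi>) * (\<Prod>i<6. h (e i) (w (\<pi> i)))) =
    pfaffian6 (\<lambda>i j. \<sigma> (w i) (w j))"
  using pfaffian6_eq_det[OF \<sigma>_bilinear \<sigma>_skew, of w "\<lambda>j i. h (e j) (w i)" e] expansion
  by (simp add: pfaffian6_frame)

lemma dual_functional:
  assumes \<beta>: "linear \<beta>"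
  shows "(\<Sum>j<6. \<beta> (J (e j)) * \<sigma> (e j) w) = \<beta> w"
proof -
  have "\<beta> w = \<beta> (\<Sum>j<6. h (e j) w *\<^sub>R e j)" using expansion[of w] by simp
  also have "\<dots> = (\<Sum>j<6. h (e j) w * \<beta> (e j))"
    by (simp add: linear_sum[OF \<beta>] linear_cmul[OF \<beta>])
  finally show ?thesis
    by (simp add: sum_lessThan_6 J_e_values \<sigma>_e_left linear_neg[OF \<beta>])
qed

text \<open>
  Since \<^const>\<open>pfaffian6\<close> only uses the entries above the diagonal, the right-hand side is
  \<open>\<beta> \<and> \<sigma> \<and> \<sigma> / 2\<close> evaluated on \<open>w 0, \<dots>, w 4\<close>.
\<close>

lemma contraction_of_pfaffian6:
  assumes \<beta>: "linear \<beta>"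
  shows "(\<Sum>j<6. \<beta> (J (e j)) * pfaffian6 (\<lambda>i k. \<sigma> (case_nat (e j) w i) (case_nat (e j) w k))) =
    pfaffian6 (\<lambda>i k. case i of 0 \<Rightarrow> \<beta> (w (k - 1)) | Suc i \<Rightarrow> \<sigma> (w i) (w (k - 1)))"
proof -
  let ?P = "pfaffian4 (\<lambda>i k. \<sigma> (w i) (w k))"
  let ?s = "\<lambda>k. \<Sum>j<6. \<beta> (J (e j)) * \<sigma> (e j) (w k)"
  have "(\<Sum>j<6. \<beta> (J (e j)) * pfaffian6 (\<lambda>i k. \<sigma> (case_nat (e j) w i) (case_nat (e j) w k))) =
    (\<Sum>j<6. \<beta> (J (e j)) * (\<sigma> (e j) (w 0) * ?P 1 2 3 4 - \<sigma> (e j) (w 1) * ?P 0 2 3 4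
      + \<sigma> (e j) (w 2) * ?P 0 1 3 4 - \<sigma> (e j) (w 3) * ?P 0 1 2 4 + \<sigma> (e j) (w 4) * ?P 0 1 2 3))"
    by (simp add: pfaffian6_def pfaffian4_def numeral_eq_Suc)
  also have "\<dots> = ?s 0 * ?P 1 2 3 4 - ?s 1 * ?P 0 2 3 4
      + ?s 2 * ?P 0 1 3 4 - ?s 3 * ?P 0 1 2 4 + ?s 4 * ?P 0 1 2 3"
    unfolding sum_distrib_right sum.distrib[symmetric] sum_subtractf[symmetric]
    by (intro sum.cong refl) (simp add: algebra_simps)
  finally show ?thesis
    unfolding dual_functional[OF \<beta>] by (simp add: pfaffian6_def pfaffian4_def numeral_eq_Suc)
qed

lemma \<sigma>_square_contraction:
  "(\<Sum>j<3. \<sigma> u v * \<sigma> (e (2 * j)) (e (2 * j + 1)) - \<sigma> u (e (2 * j)) * \<sigma> v (e (2 * j + 1))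
     + \<sigma> u (e (2 * j + 1)) * \<sigma> v (e (2 * j))) = 2 * \<sigma> u v"
proof -
  have "\<sigma> (e 0) (e (Suc 0)) = 1" "\<sigma> (e 2) (e 3) = 1" "\<sigma> (e 4) (e 5) = 1"
    by (simp_all add: \<sigma>_e_left ortho)
  moreover have "\<sigma> u v = (\<sigma> u (e 0) * \<sigma> v (e (Suc 0)) - \<sigma> u (e (Suc 0)) * \<sigma> v (e 0) + \<sigma> u (e 2) * \<sigma> v (e 3)
    - \<sigma> u (e 3) * \<sigma> v (e 2) + \<sigma> u (e 4) * \<sigma> v (e 5) - \<sigma> u (e 5) * \<sigma> v (e 4))"
    unfolding \<sigma>_e_right using \<sigma>_expand[of u v] by (simp add: algebra_simps)
  ultimately show ?thesis
    by (simp add: sum_lessThan_3 numeral_2_eq_2[symmetric] numeral_3_eq_3[symmetric] algebra_simps)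
qed

end

definition pfaffian4_deriv ::
  "(nat \<Rightarrow> nat \<Rightarrow> real) \<Rightarrow> (nat \<Rightarrow> nat \<Rightarrow> real) \<Rightarrow> nat \<Rightarrow> nat \<Rightarrow> nat \<Rightarrow> nat \<Rightarrow> real" where
  "pfaffian4_deriv s s' a b c d =
     s' a b * s c d + s a b * s' c d - (s' a c * s b d + s a c * s' b d) + (s' a d * s b c + s a d * s' b c)"

definition pfaffian5 ::
  "(nat \<Rightarrow> real) \<Rightarrow> (nat \<Rightarrow> nat \<Rightarrow> nat \<Rightarrow> nat \<Rightarrow> real) \<Rightarrow> nat \<Rightarrow> nat \<Rightarrow> nat \<Rightarrow> nat \<Rightarrow> nat \<Rightarrow> real"
where
  "pfaffian5 \<beta> P a b c d e = \<beta> a * P b c d e - \<beta> b * P a c d e + \<beta> c * P a b d e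
    - \<beta> d * P a b c e + \<beta> e * P a b c d"

lemma has_derivative_pfaffian5:
  assumes "\<And>i. ((\<lambda>x. \<beta> x i) has_derivative (\<lambda>h. \<beta>' h i)) (at x0)"
    and "\<And>i j. ((\<lambda>x. s x i j) has_derivative (\<lambda>h. s' h i j)) (at x0)"
  shows "((\<lambda>x. pfaffian5 (\<beta> x) (pfaffian4 (s x)) a b c d e) has_derivative
    (\<lambda>h. pfaffian5 (\<beta>' h) (pfaffian4 (s x0)) a b c d e
      + pfaffian5 (\<beta> x0) (pfaffian4_deriv (s x0) (s' h)) a b c d e)) (at x0)"
proof -
  have P: "((\<lambda>x. pfaffian4 (s x) a b c d) has_derivative (\<lambda>h. pfaffian4_deriv (s x0) (s' h) a b c d)) (at x0)"
    for a b c d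
    unfolding pfaffian4_def pfaffian4_deriv_def
    by (rule derivative_eq_intros assms refl)+ (simp add: algebra_simps)
  show ?thesis
    unfolding pfaffian5_def by (rule derivative_eq_intros assms P refl)+ (simp add: algebra_simps)
qed

lemma exterior_derivative_of_pfaffian5:
  fixes s :: "nat \<Rightarrow> nat \<Rightarrow> real" and s' :: "nat \<Rightarrow> nat \<Rightarrow> nat \<Rightarrow> real"
    and \<beta> :: "nat \<Rightarrow> real" and \<beta>' :: "nat \<Rightarrow> nat \<Rightarrow> real"
  assumes s: "s 0 (Suc 0) = 1" "s 0 2 = 0" "s 0 3 = 0" "s 0 4 = 0" "s 0 5 = 0" "s (Suc 0) 2 = 0" "s (Suc 0) 3 = 0"
    "s (Suc 0) 4 = 0" "s (Suc 0) 5 = 0" "s 2 3 = 1" "s 2 4 = 0" "s 2 5 = 0" "s 3 4 = 0" "s 3 5 = 0" "s 4 5 = 1"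
    and ds: "\<And>a b c. (a, b, c) \<in> {(0, Suc 0, 2), (0, Suc 0, 3), (0, Suc 0, 4), (0, Suc 0, 5), (0, 2, 3), (Suc 0, 2, 3),
      (2, 3, 4), (2, 3, 5), (0, 4, 5), (Suc 0, 4, 5), (2, 4, 5), (3, 4, 5)} \<Longrightarrow> s' a b c - s' b a c + s' c a b = 0"
  defines "D \<equiv> \<lambda>i. pfaffian5 (\<beta>' i) (pfaffian4 s)" and "D' \<equiv> \<lambda>i. pfaffian5 \<beta> (pfaffian4_deriv s (s' i))"
  shows "D 0 1 2 3 4 5 + D' 0 1 2 3 4 5 - (D 1 0 2 3 4 5 + D' 1 0 2 3 4 5) + (D 2 0 1 3 4 5 + D' 2 0 1 3 4 5)
      - (D 3 0 1 2 4 5 + D' 3 0 1 2 4 5) + (D 4 0 1 2 3 5 + D' 4 0 1 2 3 5) - (D 5 0 1 2 3 4 + D' 5 0 1 2 3 4)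
    = (\<Sum>j<3. \<beta>' (2 * j) (2 * j + 1) - \<beta>' (2 * j + 1) (2 * j))"
proof -
  have ds': "s' 2 0 (Suc 0) = s' (Suc 0) 0 2 - s' 0 (Suc 0) 2" "s' 3 0 (Suc 0) = s' (Suc 0) 0 3 - s' 0 (Suc 0) 3"
    "s' 4 0 (Suc 0) = s' (Suc 0) 0 4 - s' 0 (Suc 0) 4" "s' 5 0 (Suc 0) = s' (Suc 0) 0 5 - s' 0 (Suc 0) 5"
    "s' 0 2 3 = s' 2 0 3 - s' 3 0 2" "s' (Suc 0) 2 3 = s' 2 (Suc 0) 3 - s' 3 (Suc 0) 2"
    "s' 4 2 3 = s' 3 2 4 - s' 2 3 4" "s' 5 2 3 = s' 3 2 5 - s' 2 3 5"
    "s' 0 4 5 = s' 4 0 5 - s' 5 0 4" "s' (Suc 0) 4 5 = s' 4 (Suc 0) 5 - s' 5 (Suc 0) 4"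
    "s' 2 4 5 = s' 4 2 5 - s' 5 2 4" "s' 3 4 5 = s' 4 3 5 - s' 5 3 4"
    using ds[of 0 1 2] ds[of 0 1 3] ds[of 0 1 4] ds[of 0 1 5] ds[of 0 2 3] ds[of 1 2 3] ds[of 2 3 4] ds[of 2 3 5]
      ds[of 0 4 5] ds[of 1 4 5] ds[of 2 4 5] ds[of 3 4 5] by simp_all
  have "(\<Sum>j<3. \<beta>' (2 * j) (2 * j + 1) - \<beta>' (2 * j + 1) (2 * j)) =
    \<beta>' 0 1 - \<beta>' 1 0 + (\<beta>' 2 3 - \<beta>' 3 2) + (\<beta>' 4 5 - \<beta>' 5 4)"
    by (simp add: sum_lessThan_3)
  then show ?thesis
    by (simp add: D_def D'_def pfaffian5_def pfaffian4_def pfaffian4_deriv_def s ds' algebra_simps)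
qed

section \<open>Charts and the torus action\<close>

locale smooth_atlas =
  fixes X :: "'m topology" and A :: "('m, 'e::euclidean_space) chart set"
  assumes manifold: "smooth_manifold X A"
begin

lemma chart: "c \<in> A \<Longrightarrow> is_chart X c"
  using manifold by (auto simp: smooth_manifold_def)

lemma cdom_openin: "c \<in> A \<Longrightarrow> openin X (cdom c)"
  using chart by (auto simp: is_chart_def)

lemma cdom_topspace: "c \<in> A \<Longrightarrow> p \<in> cdom c \<Longrightarrow> p \<in> topspace X"
  using cdom_openin openin_subset by blast

lemma cimg_open: "c \<in> A \<Longrightarrow> open (cimg c)"
  using chart by (auto simp: is_chart_def)

lemma cmap_homeomorphic:
  "c \<in> A \<Longrightarrow> homeomorphic_map (subtopology X (cdom c)) (top_of_set (cimg c)) (cmap c)"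
  using chart by (auto simp: is_chart_def)

lemma topspace_cdom: "c \<in> A \<Longrightarrow> topspace (subtopology X (cdom c)) = cdom c"
  using cdom_openin openin_subset by (metis topspace_subtopology_subset)

lemma cmap_inj: "c \<in> A \<Longrightarrow> inj_on (cmap c) (cdom c)"
  using homeomorphic_imp_injective_map[OF cmap_homeomorphic] topspace_cdom by metis

lemma cinv_cmap [simp]: "c \<in> A \<Longrightarrow> p \<in> cdom c \<Longrightarrow> cinv c (cmap c p) = p"
  using cmap_inj by simp

lemma cmap_cinv [simp]: "x \<in> cimg c \<Longrightarrow> cmap c (cinv c x) = x"
  by (rule f_inv_into_f)

lemma cinv_in [simp]: "x \<in> cimg c \<Longrightarrow> cinv c x \<in> cdom c"
  by (rule inv_into_into)

lemma cmap_in: "p \<in> cdom c \<Longrightarrow> cmap c p \<in> cimg c"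
  by simp

lemma cinv_continuous:
  assumes c: "c \<in> A"
  shows "continuous_map (top_of_set (cimg c)) X (cinv c)"
proof -
  obtain g where g: "homeomorphic_maps (subtopology X (cdom c)) (top_of_set (cimg c)) (cmap c) g"
    using cmap_homeomorphic[OF c] homeomorphic_map_maps by blast
  have "continuous_map (top_of_set (cimg c)) X g"
    using g continuous_map_into_fulltopology by (auto simp: homeomorphic_maps_def)
  moreover have "g x = cinv c x" if "x \<in> cimg c" for x
  proof -
    obtain p where p: "p \<in> cdom c" "x = cmap c p" using \<open>x \<in> cimg c\<close> by blast
    have "g (cmap c p) = p"
      using g p topspace_cdom[OF c] by (simp add: homeomorphic_maps_def)
    then show ?thesis using p c by simp
  qed
  ultimately show ?thesis by (rule continuous_map_eq) simp
qed

lemma overlap_open: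
  assumes "c \<in> A" "d \<in> A"
  shows "open (cmap c ` (cdom c \<inter> cdom d))"
proof -
  have "openin (subtopology X (cdom c)) (cdom c \<inter> cdom d)"
    using assms cdom_openin by (metis Int_commute openin_subtopology_Int)
  then have "openin (top_of_set (cimg c)) (cmap c ` (cdom c \<inter> cdom d))"
    using homeomorphic_imp_open_map[OF cmap_homeomorphic[OF assms(1)]] by (auto simp: open_map_def)
  then show ?thesis using cimg_open[OF assms(1)] openin_open_trans by blast
qed

lemma transition_differentiable:
  assumes "c \<in> A" "d \<in> A" "p \<in> cdom c" "p \<in> cdom d"
  shows "(cmap d \<circ> cinv c) differentiable (at (cmap c p))"
proof (rule smooth_on_imp_differentiable)
  show "smooth_on (cmap c ` (cdom c \<inter> cdom d)) (cmap d \<circ> cinv c)"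
    using manifold assms by (auto simp: smooth_manifold_def)
qed (use assms overlap_open in auto)

abbreviation transition :: "('m, 'e) chart \<Rightarrow> ('m, 'e) chart \<Rightarrow> 'm \<Rightarrow> 'e \<Rightarrow> 'e" where
  "transition c d p \<equiv> frechet_derivative (cmap d \<circ> cinv c) (at (cmap c p))"

lemma transition_has_derivative:
  assumes "c \<in> A" "d \<in> A" "p \<in> cdom c" "p \<in> cdom d"
  shows "((cmap d \<circ> cinv c) has_derivative transition c d p) (at (cmap c p))"
  using transition_differentiable[OF assms] frechet_derivative_works by blast

lemma transition_linear:
  "\<lbrakk>c \<in> A; d \<in> A; p \<in> cdom c; p \<in> cdom d\<rbrakk> \<Longrightarrow> linear (transition c d p)"
  using transition_has_derivative has_derivative_linear by blast

lemma transition_eval: "c \<in> A \<Longrightarrow> p \<in> cdom c \<Longrightarrow> (cmap d \<circ> cinv c) (cmap c p) = cmap d p"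
  by simp

lemma transition_comp:
  assumes "c \<in> A" "d \<in> A" "e \<in> A" "p \<in> cdom c" "p \<in> cdom d" "p \<in> cdom e"
  shows "transition d e p (transition c d p a) = transition c e p a"
proof -
  have "((\<lambda>x. (cmap e \<circ> cinv d) ((cmap d \<circ> cinv c) x)) has_derivative
      (\<lambda>x. transition d e p (transition c d p x))) (at (cmap c p))"
    by (rule has_derivative_compose[OF transition_has_derivative])
      (simp_all only: transition_eval assms transition_has_derivative[OF assms(2,3,5,6)])
  then have "((cmap e \<circ> cinv c) has_derivative (\<lambda>x. transition d e p (transition c d p x))) (at (cmap c p))"
    by (rule has_derivative_transform_within_open[where s="cmap c ` (cdom c \<inter> cdom d)"])
      (use assms overlap_open in auto)
  from frechet_derivative_at[OF this] show ?thesis by metis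
qed

lemma transition_self:
  assumes "c \<in> A" "p \<in> cdom c"
  shows "transition c c p a = a"
proof -
  have "((cmap c \<circ> cinv c) has_derivative (\<lambda>x. x)) (at (cmap c p))"
    by (rule has_derivative_transform_within_open[where s="cimg c" and f="\<lambda>x. x"])
      (use assms cimg_open in auto)
  from frechet_derivative_at[OF this] show ?thesis by metis
qed

lemma chart_at:
  assumes "p \<in> topspace X"
  shows "chart_at A p \<in> A" "p \<in> cdom (chart_at A p)"
proof -
  have "\<exists>c. c \<in> A \<and> p \<in> cdom c"
    using manifold assms unfolding smooth_manifold_def by blast
  from someI_ex[OF this] show "chart_at A p \<in> A" "p \<in> cdom (chart_at A p)"
    by (simp_all add: chart_at_def)
qed

lemma coord_vec_apply:
  "d \<in> A \<Longrightarrow> p \<in> cdom d \<Longrightarrow> coord_vec A c p a d = transition c d p a"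
  by (simp add: coord_vec_def)

lemma coord_vec_self: "c \<in> A \<Longrightarrow> p \<in> cdom c \<Longrightarrow> coord_vec A c p a c = a"
  by (simp add: coord_vec_def transition_self)

lemma coord_vec_tangent:
  assumes "c \<in> A" "p \<in> cdom c"
  shows "coord_vec A c p a \<in> tangent_space A p"
  unfolding tangent_space_def mem_Collect_eq
proof (intro conjI ballI allI impI)
  fix d e assume "d \<in> A" "e \<in> A" "p \<in> cdom d \<and> p \<in> cdom e"
  then show "coord_vec A c p a e = transition d e p (coord_vec A c p a d)"
    using assms by (simp only: coord_vec_apply transition_comp)
qed (auto simp: coord_vec_def)

lemma tangent_transition:
  "\<lbrakk>v \<in> tangent_space A p; c \<in> A; d \<in> A; p \<in> cdom c; p \<in> cdom d\<rbrakk> \<Longrightarrow> v d = transition c d p (v c)"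
  unfolding tangent_space_def by blast

lemma coord_vec_of_tangent:
  assumes "c \<in> A" "p \<in> cdom c" "v \<in> tangent_space A p"
  shows "coord_vec A c p (v c) = v"
proof
  fix d
  show "coord_vec A c p (v c) d = v d"
  proof (cases "d \<in> A \<and> p \<in> cdom d")
    case True
    then show ?thesis
      using tangent_transition[OF assms(3,1) _ assms(2), of d] by (simp only: coord_vec_apply)
  next
    case False
    moreover from this have "v d = 0" using assms(3) unfolding tangent_space_def by blast
    ultimately show ?thesis unfolding coord_vec_def by (simp only: if_False)
  qed
qed

end

lemma torus_exp_in: "torus_exp \<tau> \<in> torus"
  by (simp add: torus_exp_def torus_def)

lemma torus_exp_add: "torus_exp (\<tau> + \<tau>') =
    (fst (torus_exp \<tau>) * fst (torus_exp \<tau>'), snd (torus_exp \<tau>) * snd (torus_exp \<tau>'))"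
  by (simp add: torus_exp_def cis_mult)

lemma torus_exp_0: "torus_exp 0 = (1, 1)"
  by (simp add: torus_exp_def)

locale torus_manifold = smooth_atlas X A
  for X :: "'m topology" and A :: "('m, 'e::euclidean_space) chart set" +
  fixes act :: "complex \<times> complex \<Rightarrow> 'm \<Rightarrow> 'm"
  assumes action: "smooth_torus_action X A act"
begin

lemma act_exp_0 [simp]: "p \<in> topspace X \<Longrightarrow> act (torus_exp 0) p = p"
  using action by (simp add: smooth_torus_action_def torus_exp_0)

lemma act_exp_add:
  "p \<in> topspace X \<Longrightarrow> act (torus_exp (\<tau> + \<tau>')) p = act (torus_exp \<tau>) (act (torus_exp \<tau>') p)"
  using action torus_exp_in unfolding smooth_torus_action_def torus_exp_add by blast

lemma act_continuous: "continuous_map (prod_topology (top_of_set torus) X) X (\<lambda>(s, p). act s p)"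
  using action by (auto simp: smooth_torus_action_def)

definition flow_dom :: "('m, 'e) chart \<Rightarrow> ((real \<times> real) \<times> 'e) set" where
  "flow_dom c = {(\<tau>, x). x \<in> cimg c \<and> act (torus_exp \<tau>) (cinv c x) \<in> cdom c}"

definition flow :: "('m, 'e) chart \<Rightarrow> (real \<times> real) \<times> 'e \<Rightarrow> 'e" where
  "flow c = (\<lambda>(\<tau>, x). cmap c (act (torus_exp \<tau>) (cinv c x)))"

lemma flow_smooth: "c \<in> A \<Longrightarrow> smooth_on (flow_dom c) (flow c)"
  using action by (auto simp: smooth_torus_action_def flow_dom_def flow_def)

lemma torus_exp_continuous: "continuous_on UNIV torus_exp"
  unfolding torus_exp_def cis_conv_exp by (intro continuous_intros)

lemma flow_dom_open:
  assumes c: "c \<in> A"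
  shows "open (flow_dom c)"
proof -
  let ?Y = "top_of_set (UNIV \<times> cimg c) :: ((real \<times> real) \<times> 'e) topology"
  have "continuous_map ?Y (top_of_set torus) (\<lambda>z. torus_exp (fst z))"
    using torus_exp_in
    by (auto intro!: continuous_on_compose2[OF torus_exp_continuous] continuous_intros)
  moreover have "continuous_map ?Y (top_of_set (cimg c)) snd"
    by (auto intro!: continuous_intros)
  from continuous_map_compose[OF this cinv_continuous[OF c]]
  have "continuous_map ?Y X (\<lambda>z. cinv c (snd z))"
    by (simp add: o_def)
  ultimately have "continuous_map ?Y (prod_topology (top_of_set torus) X) (\<lambda>z. (torus_exp (fst z), cinv c (snd z)))"
    by (simp add: continuous_map_pairedI)
  from continuous_map_compose[OF this act_continuous]
  have "continuous_map ?Y X (\<lambda>z. act (torus_exp (fst z)) (cinv c (snd z)))"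
    by (simp add: o_def)
  then have "openin ?Y {z \<in> topspace ?Y. act (torus_exp (fst z)) (cinv c (snd z)) \<in> cdom c}"
    using cdom_openin[OF c] by (rule openin_continuous_map_preimage)
  moreover have "{z \<in> topspace ?Y. act (torus_exp (fst z)) (cinv c (snd z)) \<in> cdom c} = flow_dom c"
    by (auto simp: flow_dom_def)
  ultimately show ?thesis
    using openin_open_trans open_Times[OF open_UNIV cimg_open[OF c]] by metis
qed

lemma zero_in_flow_dom: "c \<in> A \<Longrightarrow> x \<in> cimg c \<Longrightarrow> (0, x) \<in> flow_dom c"
  using cdom_topspace[of c "cinv c x"] by (auto simp: flow_dom_def)

lemma flow_0: "c \<in> A \<Longrightarrow> x \<in> cimg c \<Longrightarrow> flow c (0, x) = x"
  using cdom_topspace[of c "cinv c x"] by (auto simp: flow_def)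

lemma flow_has_derivative:
  "c \<in> A \<Longrightarrow> z \<in> flow_dom c \<Longrightarrow> (flow c has_derivative frechet_derivative (flow c) (at z)) (at z)"
  using smooth_on_imp_differentiable[OF flow_smooth flow_dom_open] frechet_derivative_works by blast

lemma flow_deriv_has_derivative:
  "c \<in> A \<Longrightarrow> z \<in> flow_dom c \<Longrightarrow> ((\<lambda>z. frechet_derivative (flow c) (at z) v) has_derivative
    frechet_derivative (\<lambda>z. frechet_derivative (flow c) (at z) v) (at z)) (at z)"
  using smooth_on_imp_differentiable[OF smooth_on_frechet_derivative[OF flow_smooth] flow_dom_open]
    frechet_derivative_works by blast

definition field :: "('m, 'e) chart \<Rightarrow> real \<times> real \<Rightarrow> 'e \<Rightarrow> 'e" where
  "field c \<xi> x = frechet_derivative (flow c) (at (0, x)) (\<xi>, 0)"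

definition field_deriv :: "('m, 'e) chart \<Rightarrow> real \<times> real \<Rightarrow> 'e \<Rightarrow> 'e \<Rightarrow> 'e" where
  "field_deriv c \<xi> x a = frechet_derivative (\<lambda>z. frechet_derivative (flow c) (at z) (\<xi>, 0)) (at (0, x)) (0, a)"

lemma field_has_derivative:
  assumes "c \<in> A" "x \<in> cimg c"
  shows "(field c \<xi> has_derivative field_deriv c \<xi> x) (at x)"
proof -
  have "((\<lambda>y. frechet_derivative (flow c) (at (0, y)) (\<xi>, 0)) has_derivative
     (\<lambda>a. frechet_derivative (\<lambda>z. frechet_derivative (flow c) (at z) (\<xi>, 0)) (at (0, x)) (0, a))) (at x)"
    by (rule has_derivative_compose[where f="\<lambda>y. (0, y)" and g="\<lambda>z. frechet_derivative (flow c) (at z) (\<xi>, 0)",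
          OF _ flow_deriv_has_derivative[OF assms(1) zero_in_flow_dom[OF assms]]])
       (auto intro!: derivative_eq_intros)
  then show ?thesis by (simp add: field_def[abs_def] field_deriv_def[abs_def])
qed

lemma curve_has_derivative:
  assumes "c \<in> A" "(t *\<^sub>R \<xi>, x) \<in> flow_dom c"
  shows "((\<lambda>t. flow c (t *\<^sub>R \<xi>, x)) has_derivative
    (\<lambda>k. k *\<^sub>R frechet_derivative (flow c) (at (t *\<^sub>R \<xi>, x)) (\<xi>, 0))) (at t)"
proof -
  have "((\<lambda>t. flow c (t *\<^sub>R \<xi>, x)) has_derivative
    (\<lambda>k. frechet_derivative (flow c) (at (t *\<^sub>R \<xi>, x)) (k *\<^sub>R \<xi>, 0))) (at t)"
    by (rule has_derivative_compose[where f="\<lambda>t. (t *\<^sub>R \<xi>, x)", OF _ flow_has_derivative[OF assms]])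
       (auto intro!: derivative_eq_intros)
  moreover have "frechet_derivative (flow c) (at (t *\<^sub>R \<xi>, x)) (k *\<^sub>R \<xi>, 0) =
      k *\<^sub>R frechet_derivative (flow c) (at (t *\<^sub>R \<xi>, x)) (\<xi>, 0)" for k
    using linear_cmul[OF has_derivative_linear[OF flow_has_derivative[OF assms]], of k "(\<xi>, 0)"] by simp
  ultimately show ?thesis by simp
qed

lemma curve_0_has_derivative:
  assumes "c \<in> A" "x \<in> cimg c"
  shows "((\<lambda>t. flow c (t *\<^sub>R \<xi>, x)) has_derivative (\<lambda>k. k *\<^sub>R field c \<xi> x)) (at 0)"
  using curve_has_derivative[of c 0 \<xi> x] zero_in_flow_dom[OF assms] assms
  by (simp add: field_def zero_prod_def[symmetric])

lemma generating_field_apply: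
  assumes c: "c \<in> A" and p: "p \<in> cdom c"
  shows "generating_field A act \<xi> p c = field c \<xi> (cmap c p)"
proof -
  have "((\<lambda>t. cmap c (act (torus_exp (t *\<^sub>R \<xi>)) p)) has_vector_derivative field c \<xi> (cmap c p)) (at 0)"
    using curve_0_has_derivative[OF c cmap_in[OF p], of \<xi>] c p by (simp add: flow_def has_vector_derivative_def)
  then show ?thesis using c p by (simp add: generating_field_def vector_derivative_at)
qed

lemma generating_field_tangent:
  assumes p: "p \<in> topspace X"
  shows "generating_field A act \<xi> p \<in> tangent_space A p"
proof -
  have "field d \<xi> (cmap d p) = transition c d p (field c \<xi> (cmap c p))"
    if cd: "c \<in> A" "d \<in> A" "p \<in> cdom c" "p \<in> cdom d" for c d
  proof -
    let ?x = "cmap c p"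
    have "((\<lambda>t. (cmap d \<circ> cinv c) (flow c (t *\<^sub>R \<xi>, ?x))) has_derivative
        (\<lambda>k. transition c d p (k *\<^sub>R field c \<xi> ?x))) (at 0)"
    proof (rule has_derivative_compose[OF curve_0_has_derivative])
      have "flow c (0 *\<^sub>R \<xi>, ?x) = ?x" using flow_0[of c ?x] cd by simp
      then show "((cmap d \<circ> cinv c) has_derivative transition c d p) (at (flow c (0 *\<^sub>R \<xi>, ?x)))"
        using transition_has_derivative[OF cd] by (simp only:)
    qed (use cd in auto)
    moreover have "open ((\<lambda>t. (t *\<^sub>R \<xi>, ?x)) -` flow_dom c)"
      by (intro continuous_open_vimage flow_dom_open cd continuous_intros)
    ultimately have "((\<lambda>t. cmap d (act (torus_exp (t *\<^sub>R \<xi>)) p)) has_derivative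
        (\<lambda>k. transition c d p (k *\<^sub>R field c \<xi> ?x))) (at 0)"
      by (rule has_derivative_transform_within_open)
        (use cd zero_in_flow_dom[of c ?x] in \<open>auto simp: flow_def flow_dom_def zero_prod_def[symmetric]\<close>)
    then have "((\<lambda>t. flow d (t *\<^sub>R \<xi>, cmap d p)) has_derivative
        (\<lambda>k. k *\<^sub>R transition c d p (field c \<xi> ?x))) (at 0)"
      using cd by (simp add: flow_def linear_cmul[OF transition_linear])
    from fun_cong[OF has_derivative_unique[OF this curve_0_has_derivative[OF cd(2) cmap_in[OF cd(4)]]], of 1]
    show ?thesis by simp
  qed
  then have "\<forall>c\<in>A. \<forall>d\<in>A. p \<in> cdom c \<and> p \<in> cdom d \<longrightarrow>
      generating_field A act \<xi> p d = transition c d p (generating_field A act \<xi> p c)"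
    by (intro ballI impI) (metis generating_field_apply)
  moreover have "\<forall>c. \<not> (c \<in> A \<and> p \<in> cdom c) \<longrightarrow> generating_field A act \<xi> p c = 0"
    by (simp add: generating_field_def)
  ultimately show ?thesis unfolding tangent_space_def mem_Collect_eq by (rule conjI)
qed

lemma act_curve_deriv:
  assumes "c \<in> A" "x \<in> cimg c"
  shows "((\<lambda>t. frechet_derivative (flow c) (at (t *\<^sub>R \<xi>, x)) (0, a)) has_derivative
    (\<lambda>k. k *\<^sub>R field_deriv c \<xi> x a)) (at 0)"
proof -
  let ?D = "\<lambda>v. frechet_derivative (\<lambda>z. frechet_derivative (flow c) (at z) v) (at (0, x))"
  have z: "(0 *\<^sub>R \<xi>, x) \<in> flow_dom c" using zero_in_flow_dom[OF assms] by (simp add: zero_prod_def)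
  have "((\<lambda>t. frechet_derivative (flow c) (at (t *\<^sub>R \<xi>, x)) (0, a)) has_derivative
    (\<lambda>k. ?D (0, a) (k *\<^sub>R \<xi>, 0))) (at 0)"
  proof (rule has_derivative_compose[where f="\<lambda>t. (t *\<^sub>R \<xi>, x)"])
    show "((\<lambda>z. frechet_derivative (flow c) (at z) (0, a)) has_derivative ?D (0, a)) (at (0 *\<^sub>R \<xi>, x))"
      using flow_deriv_has_derivative[OF assms(1) zero_in_flow_dom[OF assms]] by simp
  qed (auto intro!: derivative_eq_intros)
  moreover have "?D (0, a) (k *\<^sub>R \<xi>, 0) = k *\<^sub>R ?D (0, a) (\<xi>, 0)" for k
    using linear_cmul[OF has_derivative_linear[OF
        flow_deriv_has_derivative[OF assms(1) zero_in_flow_dom[OF assms], of "(0, a)"]], of k "(\<xi>, 0)"]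
    by simp
  moreover have "?D (0, a) (\<xi>, 0) = field_deriv c \<xi> x a"
    unfolding field_deriv_def
    by (rule smooth_on_symmetric_derivative[OF flow_smooth flow_dom_open zero_in_flow_dom]) (use assms in auto)
  ultimately show ?thesis by simp
qed

lemma flow_deriv_0:
  assumes "c \<in> A" "x \<in> cimg c"
  shows "frechet_derivative (flow c) (at (0, x)) (0, a) = a"
proof -
  have "((\<lambda>y. flow c (0, y)) has_derivative (\<lambda>a. frechet_derivative (flow c) (at (0, x)) (0, a))) (at x)"
    by (rule has_derivative_compose[where f="\<lambda>y. (0, y)",
          OF _ flow_has_derivative[OF assms(1) zero_in_flow_dom[OF assms]]])
       (auto intro!: derivative_eq_intros)
  then have "((\<lambda>y. y) has_derivative (\<lambda>a. frechet_derivative (flow c) (at (0, x)) (0, a))) (at x)"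
    by (rule has_derivative_transform_within_open[OF _ cimg_open[OF assms(1)] assms(2)]) (simp add: flow_0 assms)
  from has_derivative_unique[OF this has_derivative_ident] show ?thesis by metis
qed

text \<open>The flows of the two fields commute, so both sides are mixed second derivatives of the action.\<close>

lemma generating_fields_commute:
  assumes "c \<in> A" "x \<in> cimg c"
  shows "field_deriv c \<xi> x (field c \<eta> x) = field_deriv c \<eta> x (field c \<xi> x)"
proof -
  let ?D = "\<lambda>v. frechet_derivative (\<lambda>z. frechet_derivative (flow c) (at z) v) (at (0, x))"
  have *: "field_deriv c \<xi> x (field c \<eta> x) = ?D (\<xi>, 0) (\<eta>, 0)" for \<xi> \<eta>
  proof -
    let ?T = "(\<lambda>t. (t *\<^sub>R \<eta>, x)) -` flow_dom c"
    have T: "open ?T" by (intro continuous_open_vimage flow_dom_open assms continuous_intros)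
    have T0: "0 \<in> ?T" using zero_in_flow_dom[OF assms] by (simp add: zero_prod_def)
    have eq: "field c \<xi> (flow c (t *\<^sub>R \<eta>, x)) = frechet_derivative (flow c) (at (t *\<^sub>R \<eta>, x)) (\<xi>, 0)"
      if t: "t \<in> ?T" for t
    proof -
      let ?y = "flow c (t *\<^sub>R \<eta>, x)"
      have z: "(t *\<^sub>R \<eta>, x) \<in> flow_dom c" using t by simp
      have y: "?y \<in> cimg c" using z by (auto simp: flow_def flow_dom_def)
      have "((\<lambda>s. flow c (s *\<^sub>R \<xi> + t *\<^sub>R \<eta>, x)) has_derivative
          (\<lambda>k. frechet_derivative (flow c) (at (t *\<^sub>R \<eta>, x)) (k *\<^sub>R \<xi>, 0))) (at 0)"
      proof (rule has_derivative_compose[where f="\<lambda>s. (s *\<^sub>R \<xi> + t *\<^sub>R \<eta>, x)"])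
        show "(flow c has_derivative frechet_derivative (flow c) (at (t *\<^sub>R \<eta>, x))) (at (0 *\<^sub>R \<xi> + t *\<^sub>R \<eta>, x))"
          using flow_has_derivative[OF assms(1) z] by simp
      qed (auto intro!: derivative_eq_intros)
      moreover have "flow c (s *\<^sub>R \<xi> + t *\<^sub>R \<eta>, x) = flow c (s *\<^sub>R \<xi>, ?y)" for s
      proof -
        have "cinv c x \<in> topspace X" using cdom_topspace assms by simp
        moreover have "act (torus_exp (t *\<^sub>R \<eta>)) (cinv c x) \<in> cdom c" using z by (simp add: flow_dom_def)
        ultimately show ?thesis using assms by (simp add: flow_def act_exp_add)
      qed
      ultimately have "((\<lambda>s. flow c (s *\<^sub>R \<xi>, ?y)) has_derivative
          (\<lambda>k. frechet_derivative (flow c) (at (t *\<^sub>R \<eta>, x)) (k *\<^sub>R \<xi>, 0))) (at 0)" by simp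
      from fun_cong[OF has_derivative_unique[OF curve_0_has_derivative[OF assms(1) y] this], of 1]
      show ?thesis by simp
    qed
    have f0: "flow c (0 *\<^sub>R \<eta>, x) = x" using flow_0[OF assms] by (simp add: zero_prod_def)
    have "((\<lambda>t. field c \<xi> (flow c (t *\<^sub>R \<eta>, x))) has_derivative (\<lambda>k. field_deriv c \<xi> x (k *\<^sub>R field c \<eta> x))) (at 0)"
      by (rule has_derivative_compose[OF curve_0_has_derivative[OF assms]])
        (unfold f0, rule field_has_derivative[OF assms])
    then have "((\<lambda>t. frechet_derivative (flow c) (at (t *\<^sub>R \<eta>, x)) (\<xi>, 0)) has_derivative
        (\<lambda>k. field_deriv c \<xi> x (k *\<^sub>R field c \<eta> x))) (at 0)"
      by (rule has_derivative_transform_within_open[OF _ T T0]) (rule eq)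
    moreover have "((\<lambda>t. frechet_derivative (flow c) (at (t *\<^sub>R \<eta>, x)) (\<xi>, 0)) has_derivative
        (\<lambda>k. ?D (\<xi>, 0) (k *\<^sub>R \<eta>, 0))) (at 0)"
    proof (rule has_derivative_compose[where f="\<lambda>t. (t *\<^sub>R \<eta>, x)"])
      show "((\<lambda>z. frechet_derivative (flow c) (at z) (\<xi>, 0)) has_derivative ?D (\<xi>, 0)) (at (0 *\<^sub>R \<eta>, x))"
        using flow_deriv_has_derivative[OF assms(1) zero_in_flow_dom[OF assms]] by simp
    qed (auto intro!: derivative_eq_intros)
    ultimately have "(\<lambda>k. field_deriv c \<xi> x (k *\<^sub>R field c \<eta> x)) = (\<lambda>k. ?D (\<xi>, 0) (k *\<^sub>R \<eta>, 0))"
      by (rule has_derivative_unique)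
    from fun_cong[OF this, of 1] show ?thesis by simp
  qed
  show ?thesis unfolding *
    by (rule smooth_on_symmetric_derivative[OF flow_smooth flow_dom_open zero_in_flow_dom]) (use assms in auto)
qed

lemma differential_act:
  assumes q: "q \<in> topspace X" and \<tau>: "act (torus_exp \<tau>) q \<in> cdom (chart_at A q)"
  defines "c \<equiv> chart_at A q"
  shows "differential A (act (torus_exp \<tau>)) q (coord_vec A c q a) =
    coord_vec A c (act (torus_exp \<tau>) q) (frechet_derivative (flow c) (at (\<tau>, cmap c q)) (0, a))"
proof
  fix d
  let ?x = "cmap c q" and ?p = "act (torus_exp \<tau>) q"
  have c: "c \<in> A" "q \<in> cdom c" using chart_at[OF q] by (auto simp: c_def)
  have z: "(\<tau>, ?x) \<in> flow_dom c" using c \<tau> by (simp add: flow_dom_def c_def[symmetric])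
  have p: "?p \<in> cdom c" using \<tau> by (simp add: c_def)
  show "differential A (act (torus_exp \<tau>)) q (coord_vec A c q a) d =
    coord_vec A c ?p (frechet_derivative (flow c) (at (\<tau>, ?x)) (0, a)) d"
  proof (cases "d \<in> A \<and> ?p \<in> cdom d")
    case True
    have f: "((\<lambda>y. flow c (\<tau>, y)) has_derivative (\<lambda>a. frechet_derivative (flow c) (at (\<tau>, ?x)) (0, a))) (at ?x)"
      by (rule has_derivative_compose[where f="\<lambda>y. (\<tau>, y)", OF _ flow_has_derivative[OF c(1) z]])
         (auto intro!: derivative_eq_intros)
    have "flow c (\<tau>, ?x) = cmap c ?p" using c by (simp add: flow_def)
    then have "((\<lambda>y. (cmap d \<circ> cinv c) (flow c (\<tau>, y))) has_derivative
        (\<lambda>a. transition c d ?p (frechet_derivative (flow c) (at (\<tau>, ?x)) (0, a)))) (at ?x)"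
      using transition_has_derivative[of c d ?p] True c p by (intro has_derivative_compose[OF f]) metis
    moreover have "open ((\<lambda>y. (\<tau>, y)) -` flow_dom c)"
      by (intro continuous_open_vimage flow_dom_open c continuous_intros)
    ultimately have "((cmap d \<circ> act (torus_exp \<tau>) \<circ> cinv c) has_derivative
        (\<lambda>a. transition c d ?p (frechet_derivative (flow c) (at (\<tau>, ?x)) (0, a)))) (at ?x)"
      by (rule has_derivative_transform_within_open)
        (use z c in \<open>auto simp: flow_def flow_dom_def\<close>)
    from frechet_derivative_at[OF this] True c show ?thesis
      by (simp add: differential_def coord_vec_def c_def[symmetric] transition_self fun_eq_iff Let_def)
  qed (auto simp: differential_def coord_vec_def)
qed

end

section \<open>Lie derivatives along generating fields\<close>

lemma has_derivative_bilinear_family: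
  fixes f g :: "'a::real_normed_vector \<Rightarrow> 'b::euclidean_space"
    and s :: "'a \<Rightarrow> 'b \<Rightarrow> 'b \<Rightarrow> 'c::real_normed_vector"
  assumes bil: "\<forall>\<^sub>F x in nhds x0. bilinear (s x)"
    and s': "\<And>a b. ((\<lambda>x. s x a b) has_derivative (\<lambda>h. s' h a b)) (at x0)"
    and f': "(f has_derivative f') (at x0)" and g': "(g has_derivative g') (at x0)"
  shows "((\<lambda>x. s x (f x) (g x)) has_derivative
    (\<lambda>h. s' h (f x0) (g x0) + s x0 (f' h) (g x0) + s x0 (f x0) (g' h))) (at x0)"
proof (rule has_derivative_linear_family)
  show "\<forall>\<^sub>F x in nhds x0. linear (s x (f x))"
    using bil by eventually_elim (simp add: bilinear_def)
  show "((\<lambda>x. s x (f x) b) has_derivative (\<lambda>h. s' h (f x0) b + s x0 (f' h) b)) (at x0)" for b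
  proof (rule has_derivative_linear_family[where q="\<lambda>x a. s x a b" and q'="\<lambda>h a. s' h a b"])
    show "\<forall>\<^sub>F x in nhds x0. linear (\<lambda>a. s x a b)"
      using bil by eventually_elim (simp add: bilinear_def)
  qed (rule s' f')+
qed (rule g')

definition trilinear :: "('a::real_vector \<Rightarrow> 'a \<Rightarrow> 'a \<Rightarrow> 'b::real_vector) \<Rightarrow> bool" where
  "trilinear q \<longleftrightarrow> (\<forall>b c. linear (\<lambda>a. q a b c)) \<and> (\<forall>a c. linear (\<lambda>b. q a b c)) \<and> (\<forall>a b. linear (q a b))"

lemma has_derivative_trilinear_family:
  fixes f g k :: "'a::real_normed_vector \<Rightarrow> 'b::euclidean_space"
    and q :: "'a \<Rightarrow> 'b \<Rightarrow> 'b \<Rightarrow> 'b \<Rightarrow> 'c::real_normed_vector"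
  assumes tri: "\<forall>\<^sub>F x in nhds x0. trilinear (q x)"
    and q': "\<And>a b c. ((\<lambda>x. q x a b c) has_derivative (\<lambda>h. q' h a b c)) (at x0)"
    and f': "(f has_derivative f') (at x0)" and g': "(g has_derivative g') (at x0)"
    and k': "(k has_derivative k') (at x0)"
  shows "((\<lambda>x. q x (f x) (g x) (k x)) has_derivative
    (\<lambda>h. q' h (f x0) (g x0) (k x0) + q x0 (f' h) (g x0) (k x0) + q x0 (f x0) (g' h) (k x0)
       + q x0 (f x0) (g x0) (k' h))) (at x0)"
proof (rule has_derivative_linear_family)
  show "\<forall>\<^sub>F x in nhds x0. linear (q x (f x) (g x))"
    using tri by eventually_elim (simp add: trilinear_def)
  show "((\<lambda>x. q x (f x) (g x) c) has_derivative
    (\<lambda>h. q' h (f x0) (g x0) c + q x0 (f' h) (g x0) c + q x0 (f x0) (g' h) c)) (at x0)" for c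
  proof (rule has_derivative_bilinear_family[where s="\<lambda>x a b. q x a b c" and s'="\<lambda>h a b. q' h a b c"])
    show "\<forall>\<^sub>F x in nhds x0. bilinear (\<lambda>a b. q x a b c)"
      using tri by eventually_elim (simp add: trilinear_def bilinear_def)
  qed (rule q' f' g')+
qed (rule k')

lemma alternating_multilinear_3:
  assumes "alternating_multilinear 3 F"
  shows "trilinear (\<lambda>a b c. F [a, b, c])"
    and "F [b, a, c] = - F [a, b, c]" "F [a, c, b] = - F [a, b, c]"
proof -
  have L: "linear (\<lambda>a. F (as[i := a]))" if "length as = 3" "i < 3" for as i
    using assms that by (simp add: alternating_multilinear_def)
  have lin: "linear (\<lambda>a. F [a, b, c])" "linear (\<lambda>a. F [b, a, c])" "linear (\<lambda>a. F [b, c, a])" for b c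
    using L[of "[0, b, c]" 0] L[of "[b, 0, c]" 1] L[of "[b, c, 0]" 2] by (simp_all add: numeral_2_eq_2)
  have zero: "F [a, a, c] = 0" "F [c, a, a] = 0" for a c
    using assms by (simp_all add: alternating_multilinear_def)
  show "trilinear (\<lambda>a b c. F [a, b, c])" using lin by (simp add: trilinear_def)
  have "0 = F [a + b, a + b, c]" by (simp add: zero)
  also have "\<dots> = F [a, b, c] + F [b, a, c]"
    unfolding linear_add[OF lin(1)] linear_add[OF lin(2)] by (simp add: zero)
  finally show "F [b, a, c] = - F [a, b, c]" by (metis add.commute eq_neg_iff_add_eq_0)
  have "0 = F [a, b + c, b + c]" by (simp add: zero)
  also have "\<dots> = F [a, b, c] + F [a, c, b]"
    unfolding linear_add[OF lin(2)] linear_add[OF lin(3)] by (simp add: zero)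
  finally show "F [a, c, b] = - F [a, b, c]" by (metis add.commute eq_neg_iff_add_eq_0)
qed

lemma eventually_nhds_comp:
  assumes "\<forall>\<^sub>F y in nhds (f x). P y" "isCont f x"
  shows "\<forall>\<^sub>F z in nhds x. P (f z)"
proof -
  have "(f \<longlongrightarrow> f x) (nhds x)"
    using assms(2) unfolding isCont_def tendsto_at_iff_tendsto_nhds .
  then show ?thesis using assms(1) by (simp add: filterlim_iff)
qed

context torus_manifold
begin

lemma flow_deriv_curve_0: "c \<in> A \<Longrightarrow> x \<in> cimg c \<Longrightarrow> flow c (0 *\<^sub>R \<xi>, x) = x"
  "c \<in> A \<Longrightarrow> x \<in> cimg c \<Longrightarrow> frechet_derivative (flow c) (at (0 *\<^sub>R \<xi>, x)) (0, a) = a"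
  using flow_0[of c x] flow_deriv_0[of c x a] by simp_all

lemma has_derivative_along_flow:
  fixes q :: "'e \<Rightarrow> 'b::real_normed_vector"
  assumes "c \<in> A" "x \<in> cimg c" and q: "(q has_derivative q') (at x)"
  shows "((\<lambda>t. q (flow c (t *\<^sub>R \<xi>, x))) has_derivative (\<lambda>k. q' (k *\<^sub>R field c \<xi> x))) (at 0)"
  by (rule has_derivative_compose[OF curve_0_has_derivative[OF assms(1,2)]])
    (simp only: flow_deriv_curve_0[OF assms(1,2)] q)

lemma flow_dom_near:
  assumes "c \<in> A" "x \<in> cimg c"
  shows "open ((\<lambda>t. (t *\<^sub>R \<xi>, x)) -` flow_dom c)" "0 \<in> (\<lambda>t. (t *\<^sub>R \<xi>, x)) -` flow_dom c"
proof -
  show "open ((\<lambda>t. (t *\<^sub>R \<xi>, x)) -` flow_dom c)"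
    by (intro continuous_open_vimage flow_dom_open assms continuous_intros)
  show "0 \<in> (\<lambda>t. (t *\<^sub>R \<xi>, x)) -` flow_dom c" using zero_in_flow_dom[OF assms] by simp
qed

lemma along_flow_isCont:
  assumes "c \<in> A" "x \<in> cimg c"
  shows "isCont (\<lambda>t. flow c (t *\<^sub>R \<xi>, x)) 0"
  using has_derivative_continuous[OF curve_0_has_derivative[OF assms]] by simp

lemma invariant_bilinear_family:
  fixes s :: "'e \<Rightarrow> 'e \<Rightarrow> 'e \<Rightarrow> real"
  assumes c: "c \<in> A" "x \<in> cimg c"
    and bil: "\<And>y. y \<in> cimg c \<Longrightarrow> bilinear (s y)"
    and s': "\<And>a b. ((\<lambda>y. s y a b) has_derivative (\<lambda>h. s' h a b)) (at x)"
    and inv: "\<And>t a b. (t *\<^sub>R \<xi>, x) \<in> flow_dom c \<Longrightarrow> s (flow c (t *\<^sub>R \<xi>, x))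
        (frechet_derivative (flow c) (at (t *\<^sub>R \<xi>, x)) (0, a)) (frechet_derivative (flow c) (at (t *\<^sub>R \<xi>, x)) (0, b))
      = s x a b"
  shows "s' (field c \<xi> x) a b + s x (field_deriv c \<xi> x a) b + s x a (field_deriv c \<xi> x b) = 0"
proof -
  let ?B = "\<lambda>t a. frechet_derivative (flow c) (at (t *\<^sub>R \<xi>, x)) (0, a)"
  let ?s = "\<lambda>t. s (flow c (t *\<^sub>R \<xi>, x))"
  note zero = flow_deriv_curve_0[OF c]
  have "\<forall>\<^sub>F y in nhds (flow c (0 *\<^sub>R \<xi>, x)). bilinear (s y)"
    unfolding zero using bil cimg_open[OF c(1)] c(2) by (auto simp: eventually_nhds)
  from eventually_nhds_comp[OF this along_flow_isCont[OF c]]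
  have "\<forall>\<^sub>F t in nhds 0. bilinear (?s t)" .
  from has_derivative_bilinear_family[OF this has_derivative_along_flow[OF c s']
      act_curve_deriv[OF c, of \<xi> a] act_curve_deriv[OF c, of \<xi> b]]
  have "((\<lambda>t. ?s t (?B t a) (?B t b)) has_derivative
    (\<lambda>k. s' (k *\<^sub>R field c \<xi> x) a b + s x (k *\<^sub>R field_deriv c \<xi> x a) b + s x a (k *\<^sub>R field_deriv c \<xi> x b))) (at 0)"
    unfolding zero .
  then have "((\<lambda>t. s x a b) has_derivative
    (\<lambda>k. s' (k *\<^sub>R field c \<xi> x) a b + s x (k *\<^sub>R field_deriv c \<xi> x a) b + s x a (k *\<^sub>R field_deriv c \<xi> x b))) (at 0)"
    by (rule has_derivative_transform_within_open[OF _ flow_dom_near[OF c, of \<xi>]]) (simp add: inv)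
  from fun_cong[OF has_derivative_unique[OF this has_derivative_const], of 1] show ?thesis by simp
qed

lemma invariant_trilinear_family:
  fixes q :: "'e \<Rightarrow> 'e \<Rightarrow> 'e \<Rightarrow> 'e \<Rightarrow> real"
  assumes c: "c \<in> A" "x \<in> cimg c"
    and tri: "\<And>y. y \<in> cimg c \<Longrightarrow> trilinear (q y)"
    and q': "\<And>a b d. ((\<lambda>y. q y a b d) has_derivative (\<lambda>h. q' h a b d)) (at x)"
    and inv: "\<And>t a b d. (t *\<^sub>R \<xi>, x) \<in> flow_dom c \<Longrightarrow> q (flow c (t *\<^sub>R \<xi>, x))
        (frechet_derivative (flow c) (at (t *\<^sub>R \<xi>, x)) (0, a)) (frechet_derivative (flow c) (at (t *\<^sub>R \<xi>, x)) (0, b))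
        (frechet_derivative (flow c) (at (t *\<^sub>R \<xi>, x)) (0, d))
      = q x a b d"
  shows "q' (field c \<xi> x) a b d + q x (field_deriv c \<xi> x a) b d + q x a (field_deriv c \<xi> x b) d
    + q x a b (field_deriv c \<xi> x d) = 0"
proof -
  let ?B = "\<lambda>t a. frechet_derivative (flow c) (at (t *\<^sub>R \<xi>, x)) (0, a)"
  let ?q = "\<lambda>t. q (flow c (t *\<^sub>R \<xi>, x))"
  note zero = flow_deriv_curve_0[OF c]
  have "\<forall>\<^sub>F y in nhds (flow c (0 *\<^sub>R \<xi>, x)). trilinear (q y)"
    unfolding zero using tri cimg_open[OF c(1)] c(2) by (auto simp: eventually_nhds)
  from eventually_nhds_comp[OF this along_flow_isCont[OF c]]
  have "\<forall>\<^sub>F t in nhds 0. trilinear (?q t)" .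
  from has_derivative_trilinear_family[OF this has_derivative_along_flow[OF c q'] act_curve_deriv[OF c, of \<xi> a]
     act_curve_deriv[OF c, of \<xi> b] act_curve_deriv[OF c, of \<xi> d]]
  have "((\<lambda>t. ?q t (?B t a) (?B t b) (?B t d)) has_derivative
    (\<lambda>k. q' (k *\<^sub>R field c \<xi> x) a b d + q x (k *\<^sub>R field_deriv c \<xi> x a) b d + q x a (k *\<^sub>R field_deriv c \<xi> x b) d
      + q x a b (k *\<^sub>R field_deriv c \<xi> x d))) (at 0)"
    unfolding zero .
  then have "((\<lambda>t. q x a b d) has_derivative
    (\<lambda>k. q' (k *\<^sub>R field c \<xi> x) a b d + q x (k *\<^sub>R field_deriv c \<xi> x a) b d + q x a (k *\<^sub>R field_deriv c \<xi> x b) d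
      + q x a b (k *\<^sub>R field_deriv c \<xi> x d))) (at 0)"
    by (rule has_derivative_transform_within_open[OF _ flow_dom_near[OF c, of \<xi>]]) (simp add: inv)
  from fun_cong[OF has_derivative_unique[OF this has_derivative_const], of 1] show ?thesis by simp
qed

end

section \<open>Nearly Kaehler structures in charts\<close>

locale nearly_kaehler_torus = torus_manifold X A act
  for X :: "'m topology" and A :: "('m, real ^ 6) chart set" and act :: "complex \<times> complex \<Rightarrow> 'm \<Rightarrow> 'm" +
  fixes g :: "'m \<Rightarrow> ('m, real ^ 6) tangent \<Rightarrow> ('m, real ^ 6) tangent \<Rightarrow> real"
    and J :: "'m \<Rightarrow> ('m, real ^ 6) tangent \<Rightarrow> ('m, real ^ 6) tangent"
    and \<psi> :: "('m, real ^ 6, complex) form"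
  assumes nk: "nearly_kaehler X A g J \<psi>"
    and preserves: "preserves_su3_structure X A g J \<psi> act"
begin

lemma su3: "su3_structure X A g J \<psi>"
  using nk by (simp add: nearly_kaehler_def)

lemma metric: "riemannian_metric A g" and acs: "almost_complex_structure A J" and \<psi>_form: "smooth_form A 3 \<psi>"
  using su3 by (simp_all add: su3_structure_def)

lemma J_tangent: "\<lbrakk>p \<in> topspace X; v \<in> tangent_space A p\<rbrakk> \<Longrightarrow> J p v \<in> tangent_space A p"
  using acs chart_at[of p] by (auto simp: almost_complex_structure_def)

definition vec :: "('m, real ^ 6) chart \<Rightarrow> real ^ 6 \<Rightarrow> real ^ 6 \<Rightarrow> ('m, real ^ 6) tangent" where
  "vec c x a = coord_vec A c (cinv c x) a"

definition G :: "('m, real ^ 6) chart \<Rightarrow> real ^ 6 \<Rightarrow> real ^ 6 \<Rightarrow> real ^ 6 \<Rightarrow> real" where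
  "G c x a b = g (cinv c x) (vec c x a) (vec c x b)"

definition Jc :: "('m, real ^ 6) chart \<Rightarrow> real ^ 6 \<Rightarrow> real ^ 6 \<Rightarrow> real ^ 6" where
  "Jc c x a = J (cinv c x) (vec c x a) c"

definition \<Psi> :: "('m, real ^ 6) chart \<Rightarrow> real ^ 6 \<Rightarrow> real ^ 6 \<Rightarrow> real ^ 6 \<Rightarrow> real ^ 6 \<Rightarrow> complex" where
  "\<Psi> c x a b d = \<psi> (cinv c x) [vec c x a, vec c x b, vec c x d]"

definition S :: "('m, real ^ 6) chart \<Rightarrow> real ^ 6 \<Rightarrow> real ^ 6 \<Rightarrow> real ^ 6 \<Rightarrow> real" where
  "S c x a b = G c x (Jc c x a) b"

context
  fixes c x assumes c: "c \<in> A" and x: "x \<in> cimg c"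
begin

lemma point: "cinv c x \<in> topspace X" "cinv c x \<in> cdom c"
  using c x cdom_topspace by auto

lemma vec_tangent: "vec c x a \<in> tangent_space A (cinv c x)"
  unfolding vec_def using c point by (intro coord_vec_tangent) auto

lemma vec_self: "vec c x a c = a"
  unfolding vec_def using c point by (intro coord_vec_self) auto

lemma vec_of_tangent: "v \<in> tangent_space A (cinv c x) \<Longrightarrow> vec c x (v c) = v"
  unfolding vec_def using c point by (intro coord_vec_of_tangent) auto

lemma vec_Jc: "vec c x (Jc c x a) = J (cinv c x) (vec c x a)"
  unfolding Jc_def by (intro vec_of_tangent J_tangent vec_tangent point)

lemma S_eq: "S c x a b = fundamental_form g J (cinv c x) [vec c x a, vec c x b]"
  by (simp add: S_def G_def vec_Jc fundamental_form_def)

lemma G_bilinear: "bilinear (G c x)" and G_sym: "G c x a b = G c x b a" and G_pos: "a \<noteq> 0 \<Longrightarrow> 0 < G c x a a"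
  using metric c x unfolding riemannian_metric_def G_def[abs_def] vec_def Let_def by blast+

lemma Jc_linear: "linear (Jc c x)"
  using acs c x unfolding almost_complex_structure_def Jc_def[abs_def] vec_def by blast

lemma Jc_Jc: "Jc c x (Jc c x a) = - a"
proof -
  have "J (cinv c x) (J (cinv c x) (vec c x a)) = (\<lambda>d. - vec c x a d)"
    using acs c point vec_tangent unfolding almost_complex_structure_def by blast
  then show ?thesis unfolding Jc_def[of c x "Jc c x a"] vec_Jc by (simp add: vec_self)
qed

lemma \<Psi>_form: "alternating_multilinear 3 (form_in_chart A c \<psi> x)"
  using \<psi>_form c x unfolding smooth_form_def by blast

lemma \<Psi>_eq: "\<Psi> c x a b d = form_in_chart A c \<psi> x [a, b, d]"
  by (simp add: \<Psi>_def vec_def form_in_chart_def)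

lemma \<Psi>_trilinear: "trilinear (\<Psi> c x)"
  and \<Psi>_skew: "\<Psi> c x b a d = - \<Psi> c x a b d" "\<Psi> c x a d b = - \<Psi> c x a b d"
proof -
  have "\<Psi> c x = (\<lambda>a b d. form_in_chart A c \<psi> x [a, b, d])" by (intro ext) (rule \<Psi>_eq)
  then show "trilinear (\<Psi> c x)" using alternating_multilinear_3(1)[OF \<Psi>_form] by (simp only:)
  show "\<Psi> c x b a d = - \<Psi> c x a b d" "\<Psi> c x a d b = - \<Psi> c x a b d"
    unfolding \<Psi>_eq by (rule alternating_multilinear_3[OF \<Psi>_form])+
qed

lemma \<Psi>_Jc: "\<Psi> c x (Jc c x a) b d = \<i> * \<Psi> c x a b d"
  using su3 point vec_tangent unfolding su3_structure_def \<Psi>_def vec_Jc by blast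

lemma \<Psi>_Jc': "\<Psi> c x a b (Jc c x d) = \<i> * \<Psi> c x a b d"
proof -
  have rotate: "\<Psi> c x a b d = \<Psi> c x d a b" for a b d
  proof -
    have "\<Psi> c x a b d = - \<Psi> c x a d b" "\<Psi> c x a d b = - \<Psi> c x d a b" by (rule \<Psi>_skew)+
    then show ?thesis by (simp only: minus_minus)
  qed
  show ?thesis using \<Psi>_Jc[of d a b] by (simp only: rotate[of a b d] rotate[of a b "Jc c x d"])
qed

lemma \<Psi>_Jc_self: "\<Psi> c x a b (Jc c x b) = 0" "\<Psi> c x a (Jc c x a) b = 0"
proof -
  have "\<Psi> c x a b b = - \<Psi> c x a b b" "\<Psi> c x a a b = - \<Psi> c x a a b"
    by (rule \<Psi>_skew)+
  moreover have "z = - z \<Longrightarrow> z = 0" for z :: complex by (simp add: complex_eq_iff)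
  ultimately have z: "\<Psi> c x a b b = 0" "\<Psi> c x a a b = 0" by blast+
  then show "\<Psi> c x a b (Jc c x b) = 0" by (simp add: \<Psi>_Jc')
  have "\<Psi> c x a (Jc c x a) b = - \<Psi> c x (Jc c x a) a b" by (rule \<Psi>_skew(1))
  then show "\<Psi> c x a (Jc c x a) b = 0" using z by (simp add: \<Psi>_Jc)
qed

lemma Im_\<Psi>_trilinear: "trilinear (\<lambda>a b d. Im (\<Psi> c x a b d))"
proof -
  have Im: "linear (\<lambda>a. Im (f a))" if "linear f" for f :: "real ^ 6 \<Rightarrow> complex"
    using linear_compose[OF that bounded_linear.linear[OF bounded_linear_Im]] by (simp only: comp_def)
  show ?thesis
    using \<Psi>_trilinear unfolding trilinear_def by (intro conjI allI Im) blast+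
qed

lemma S_bilinear: "bilinear (S c x)"
proof -
  have "linear (\<lambda>a. G c x (Jc c x a) b)" for b
    using linear_compose[OF Jc_linear, of "\<lambda>a. G c x a b"] G_bilinear
    unfolding bilinear_def comp_def by blast
  then show ?thesis using G_bilinear unfolding S_def[abs_def] bilinear_def by blast
qed

lemma G_differentiable: "(\<lambda>x. G c x a b) differentiable (at x)"
proof (rule smooth_on_imp_differentiable[OF _ cimg_open[OF c] x])
  show "smooth_on (cimg c) (\<lambda>x. G c x a b)"
    using metric c unfolding riemannian_metric_def G_def vec_def Let_def by blast
qed

lemma Jc_differentiable: "(\<lambda>x. Jc c x a) differentiable (at x)"
proof (rule smooth_on_imp_differentiable[OF _ cimg_open[OF c] x])
  show "smooth_on (cimg c) (\<lambda>x. Jc c x a)"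
    using acs c unfolding almost_complex_structure_def Jc_def vec_def by blast
qed

lemma \<Psi>_differentiable: "(\<lambda>x. \<Psi> c x a b d) differentiable (at x)"
proof (rule smooth_on_imp_differentiable[OF _ cimg_open[OF c] x])
  show "smooth_on (cimg c) (\<lambda>x. \<Psi> c x a b d)"
    using \<psi>_form c unfolding smooth_form_def \<Psi>_def vec_def form_in_chart_def
    by (auto dest!: bspec spec[of _ "[a, b, d]"])
qed

end

lemma eventually_cimg: "c \<in> A \<Longrightarrow> x \<in> cimg c \<Longrightarrow> (\<And>y. y \<in> cimg c \<Longrightarrow> P y) \<Longrightarrow> \<forall>\<^sub>F y in nhds x. P y"
  using cimg_open[of c] by (auto simp: eventually_nhds)

definition dS :: "('m, real ^ 6) chart \<Rightarrow> real ^ 6 \<Rightarrow> real ^ 6 \<Rightarrow> real ^ 6 \<Rightarrow> real ^ 6 \<Rightarrow> real" where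
  "dS c x h a b = frechet_derivative (\<lambda>x. S c x a b) (at x) h"

definition dI :: "('m, real ^ 6) chart \<Rightarrow> real ^ 6 \<Rightarrow> real ^ 6 \<Rightarrow> real ^ 6 \<Rightarrow> real ^ 6 \<Rightarrow> real ^ 6 \<Rightarrow> real" where
  "dI c x h a b d = frechet_derivative (\<lambda>x. Im (\<Psi> c x a b d)) (at x) h"

lemma S_has_derivative:
  assumes c: "c \<in> A" "x \<in> cimg c"
  shows "((\<lambda>x. S c x a b) has_derivative (\<lambda>h. dS c x h a b)) (at x)"
proof -
  have "((\<lambda>y. G c y (Jc c y a) b) has_derivative (\<lambda>h. frechet_derivative (\<lambda>y. G c y (Jc c x a) b) (at x) h
      + G c x (frechet_derivative (\<lambda>y. Jc c y a) (at x) h) b)) (at x)"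
  proof (rule has_derivative_linear_family[where q="\<lambda>y a. G c y a b"])
    show "\<forall>\<^sub>F y in nhds x. linear (\<lambda>a. G c y a b)"
      using G_bilinear c(1) by (intro eventually_cimg[OF c]) (auto simp: bilinear_def)
  qed (use G_differentiable[OF c] Jc_differentiable[OF c] frechet_derivative_works in blast)+
  then have "(\<lambda>x. S c x a b) differentiable (at x)" unfolding S_def differentiable_def by blast
  then show ?thesis unfolding dS_def frechet_derivative_works .
qed

lemma I_has_derivative:
  assumes c: "c \<in> A" "x \<in> cimg c"
  shows "((\<lambda>x. Im (\<Psi> c x a b d)) has_derivative (\<lambda>h. dI c x h a b d)) (at x)"
proof -
  have "((\<lambda>x. \<Psi> c x a b d) has_derivative frechet_derivative (\<lambda>x. \<Psi> c x a b d) (at x)) (at x)"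
    using \<Psi>_differentiable[OF c] frechet_derivative_works by blast
  from bounded_linear.has_derivative[OF bounded_linear_Im this]
  have "(\<lambda>x. Im (\<Psi> c x a b d)) differentiable (at x)" unfolding differentiable_def by blast
  then show ?thesis unfolding dI_def frechet_derivative_works .
qed

context
  fixes q assumes q: "q \<in> topspace X"
begin

abbreviation (input) "c0 \<equiv> chart_at A q"
abbreviation (input) "x0 \<equiv> cmap c0 q"

lemma base: "c0 \<in> A" "q \<in> cdom c0" "x0 \<in> cimg c0" "cinv c0 x0 = q"
  using chart_at[OF q] by auto

lemma ext_deriv_1:
  "ext_deriv A (\<lambda>q _. f q) q [v] = frechet_derivative (\<lambda>x. f (cinv c0 x)) (at x0) (v c0)"
  by (simp add: ext_deriv_def form_in_chart_def Let_def)

lemma d\<sigma>: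
  "dS c0 x0 a b d - dS c0 x0 b a d + dS c0 x0 d a b = 3 * Re (\<Psi> c0 x0 a b d)"
proof -
  let ?v = "vec c0 x0"
  have s: "form_in_chart A c0 (fundamental_form g J) x [a, b] = S c0 x a b" if "x \<in> cimg c0" for x a b
    using S_eq[OF base(1) that] by (simp add: form_in_chart_def vec_def)
  have d: "frechet_derivative (\<lambda>x. form_in_chart A c0 (fundamental_form g J) x [a, b]) (at x0) h = dS c0 x0 h a b"
    for a b h
  proof -
    have "((\<lambda>x. form_in_chart A c0 (fundamental_form g J) x [a, b]) has_derivative (\<lambda>h. dS c0 x0 h a b)) (at x0)"
      by (rule has_derivative_transform_within_open[OF S_has_derivative[OF base(1,3)] cimg_open[OF base(1)] base(3)])
        (simp add: s)
    from fun_cong[OF frechet_derivative_at[OF this], of h] show ?thesis by simp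
  qed
  have "ext_deriv A (fundamental_form g J) q [?v a, ?v b, ?v d] = dS c0 x0 a b d - dS c0 x0 b a d + dS c0 x0 d a b"
    by (simp add: ext_deriv_def Let_def eval_nat_numeral vec_self[OF base(1,3)] d)
  moreover have "ext_deriv A (fundamental_form g J) q [?v a, ?v b, ?v d] = 3 * Re (\<psi> q [?v a, ?v b, ?v d])"
    using nk q vec_tangent[OF base(1,3)] base(4) unfolding nearly_kaehler_def by auto
  ultimately show ?thesis using base(4) by (simp add: \<Psi>_def)
qed

lemma S_skew_at: "S c0 x0 b a = - S c0 x0 a b"
proof -
  have *: "G c0 x0 (Jc c0 x0 a) (Jc c0 x0 b) = G c0 x0 a b" for a b
    using su3 q vec_tangent[OF base(1,3)] base(4) unfolding su3_structure_def G_def vec_Jc[OF base(1,3)] by auto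
  have "S c0 x0 b a = G c0 x0 (Jc c0 x0 (Jc c0 x0 b)) (Jc c0 x0 a)" unfolding S_def * ..
  also have "\<dots> = - S c0 x0 a b"
    unfolding Jc_Jc[OF base(1,3)] S_def by (simp add: bilinear_lneg[OF G_bilinear[OF base(1,3)]]
        G_sym[OF base(1,3), of b])
  finally show ?thesis .
qed

lemma d\<psi>:
  "dI c0 x0 a b d e - dI c0 x0 b a d e + dI c0 x0 d a b e - dI c0 x0 e a b d =
    -4 * (S c0 x0 a b * S c0 x0 d e - S c0 x0 a d * S c0 x0 b e + S c0 x0 a e * S c0 x0 b d)"
proof -
  let ?v = "vec c0 x0"
  let ?I = "\<lambda>q ws. Im (\<psi> q ws)"
  have d: "frechet_derivative (\<lambda>x. form_in_chart A c0 ?I x [a, b, d]) (at x0) h = dI c0 x0 h a b d" for a b d h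
  proof -
    have "((\<lambda>x. form_in_chart A c0 ?I x [a, b, d]) has_derivative (\<lambda>h. dI c0 x0 h a b d)) (at x0)"
      using I_has_derivative[OF base(1,3)] by (simp add: form_in_chart_def \<Psi>_def vec_def)
    from fun_cong[OF frechet_derivative_at[OF this], of h] show ?thesis by simp
  qed
  have s: "fundamental_form g J q [?v a, ?v b] = S c0 x0 a b" for a b
    using S_eq[OF base(1,3)] base(4) by simp
  have "ext_deriv A ?I q [?v a, ?v b, ?v d, ?v e] =
     dI c0 x0 a b d e - dI c0 x0 b a d e + dI c0 x0 d a b e - dI c0 x0 e a b d"
    by (simp add: ext_deriv_def Let_def eval_nat_numeral vec_self[OF base(1,3)] d)
  moreover have "ext_deriv A ?I q [?v a, ?v b, ?v d, ?v e] =
     - 2 * wedge 2 2 (fundamental_form g J q) (fundamental_form g J q) [?v a, ?v b, ?v d, ?v e]"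
    using nk q vec_tangent[OF base(1,3)] base(4) unfolding nearly_kaehler_def by auto
  moreover have "wedge 2 2 (fundamental_form g J q) (fundamental_form g J q) [?v a, ?v b, ?v d, ?v e] =
    2 * (S c0 x0 a b * S c0 x0 d e - S c0 x0 a d * S c0 x0 b e + S c0 x0 a e * S c0 x0 b d)"
    unfolding wedge_2_2 Let_def s S_skew_at[of b a] S_skew_at[of d a] S_skew_at[of e a] S_skew_at[of d b]
      S_skew_at[of e b] S_skew_at[of e d]
    by simp
  ultimately show ?thesis by simp
qed

lemma flow_point:
  assumes "(\<tau>, x0) \<in> flow_dom c0"
  shows "flow c0 (\<tau>, x0) \<in> cimg c0" "cinv c0 (flow c0 (\<tau>, x0)) = act (torus_exp \<tau>) q"
    "differential A (act (torus_exp \<tau>)) q (vec c0 x0 a) =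
      vec c0 (flow c0 (\<tau>, x0)) (frechet_derivative (flow c0) (at (\<tau>, x0)) (0, a))"
proof -
  have p: "act (torus_exp \<tau>) q \<in> cdom c0" using assms base by (simp add: flow_dom_def)
  have f: "flow c0 (\<tau>, x0) = cmap c0 (act (torus_exp \<tau>) q)" using base(4) by (simp add: flow_def)
  show "flow c0 (\<tau>, x0) \<in> cimg c0" "cinv c0 (flow c0 (\<tau>, x0)) = act (torus_exp \<tau>) q"
    unfolding f using p base by auto
  then show "differential A (act (torus_exp \<tau>)) q (vec c0 x0 a) =
      vec c0 (flow c0 (\<tau>, x0)) (frechet_derivative (flow c0) (at (\<tau>, x0)) (0, a))"
    using differential_act[OF q p] base(4) by (simp add: vec_def)
qed

lemma preserves_at:
  assumes "s \<in> torus" "u \<in> tangent_space A q" "v \<in> tangent_space A q" "w \<in> tangent_space A q"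
  defines "D \<equiv> differential A (act s) q"
  shows "g (act s q) (D u) (D v) = g q u v" "J (act s q) (D u) = D (J q u)"
    "\<psi> (act s q) [D u, D v, D w] = \<psi> q [u, v, w]"
  using preserves assms q unfolding preserves_su3_structure_def Let_def by blast+

lemma S_invariant:
  assumes "(\<tau>, x0) \<in> flow_dom c0"
  shows "S c0 (flow c0 (\<tau>, x0)) (frechet_derivative (flow c0) (at (\<tau>, x0)) (0, a))
      (frechet_derivative (flow c0) (at (\<tau>, x0)) (0, b)) = S c0 x0 a b"
proof -
  have t: "vec c0 x0 a \<in> tangent_space A q" for a using vec_tangent[OF base(1,3)] base(4) by simp
  show ?thesis
    unfolding S_eq[OF base(1) flow_point(1)[OF assms]] S_eq[OF base(1,3)] flow_point(3)[OF assms, symmetric]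
      flow_point(2)[OF assms] base(4) fundamental_form_def
    using preserves_at(1)[OF torus_exp_in J_tangent[OF q t] t t] preserves_at(2)[OF torus_exp_in t t t] by simp
qed

lemma \<Psi>_invariant:
  assumes "(\<tau>, x0) \<in> flow_dom c0"
  shows "\<Psi> c0 (flow c0 (\<tau>, x0)) (frechet_derivative (flow c0) (at (\<tau>, x0)) (0, a))
      (frechet_derivative (flow c0) (at (\<tau>, x0)) (0, b)) (frechet_derivative (flow c0) (at (\<tau>, x0)) (0, d))
    = \<Psi> c0 x0 a b d"
proof -
  have t: "vec c0 x0 a \<in> tangent_space A q" for a using vec_tangent[OF base(1,3)] base(4) by simp
  show ?thesis
    unfolding \<Psi>_def flow_point(3)[OF assms, symmetric] flow_point(2)[OF assms] base(4)
    by (rule preserves_at(3)) (simp_all add: torus_exp_in t)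
qed

lemma lie_derivative_S:
  "dS c0 x0 (field c0 \<xi> x0) a b + S c0 x0 (field_deriv c0 \<xi> x0 a) b + S c0 x0 a (field_deriv c0 \<xi> x0 b) = 0"
  by (rule invariant_bilinear_family[OF base(1,3) S_bilinear[OF base(1)] S_has_derivative[OF base(1,3)]])
    (auto intro: S_invariant)

lemma lie_derivative_I:
  "dI c0 x0 (field c0 \<xi> x0) a b d + Im (\<Psi> c0 x0 (field_deriv c0 \<xi> x0 a) b d)
    + Im (\<Psi> c0 x0 a (field_deriv c0 \<xi> x0 b) d) + Im (\<Psi> c0 x0 a b (field_deriv c0 \<xi> x0 d)) = 0"
  by (rule invariant_trilinear_family[OF base(1,3) Im_\<Psi>_trilinear[OF base(1)] I_has_derivative[OF base(1,3)]])
    (auto simp: \<Psi>_invariant)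

lemma multi_moment_map_chart:
  assumes "x \<in> cimg c0"
  shows "multi_moment_map g J (generating_field A act \<xi>) (generating_field A act \<eta>) (cinv c0 x) =
    S c0 x (field c0 \<xi> x) (field c0 \<eta> x)"
proof -
  note p = point[OF base(1) assms]
  have "vec c0 x (field c0 \<xi> x) = generating_field A act \<xi> (cinv c0 x)" for \<xi>
    using vec_of_tangent[OF base(1) assms generating_field_tangent[OF p(1)], of \<xi>]
      generating_field_apply[OF base(1) p(2)] assms by simp
  then show ?thesis by (simp add: multi_moment_map_def S_eq[OF base(1) assms])
qed

lemma d_multi_moment_map:
  "frechet_derivative (\<lambda>x. multi_moment_map g J (generating_field A act \<xi>) (generating_field A act \<eta>) (cinv c0 x)) (at x0) a
   = 3 * Re (\<Psi> c0 x0 (field c0 \<xi> x0) (field c0 \<eta> x0) a)"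
proof -
  let ?u = "field c0 \<xi>" and ?v = "field c0 \<eta>" and ?u' = "field_deriv c0 \<xi> x0" and ?v' = "field_deriv c0 \<eta> x0"
  have "((\<lambda>x. S c0 x (?u x) (?v x)) has_derivative
    (\<lambda>h. dS c0 x0 h (?u x0) (?v x0) + S c0 x0 (?u' h) (?v x0) + S c0 x0 (?u x0) (?v' h))) (at x0)"
    by (rule has_derivative_bilinear_family[OF eventually_cimg[OF base(1,3) S_bilinear[OF base(1)]]])
      (assumption | rule S_has_derivative field_has_derivative base)+
  then have "((\<lambda>x. multi_moment_map g J (generating_field A act \<xi>) (generating_field A act \<eta>) (cinv c0 x)) has_derivative
    (\<lambda>h. dS c0 x0 h (?u x0) (?v x0) + S c0 x0 (?u' h) (?v x0) + S c0 x0 (?u x0) (?v' h))) (at x0)"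
    by (rule has_derivative_transform_within_open[OF _ cimg_open[OF base(1)] base(3)])
      (simp add: multi_moment_map_chart)
  from frechet_derivative_at[OF this, symmetric]
  show ?thesis
    using d\<sigma>[of "?u x0" "?v x0" a] lie_derivative_S[of \<xi> "?v x0" a] lie_derivative_S[of \<eta> "?u x0" a]
      generating_fields_commute[OF base(1,3), of \<xi> \<eta>] S_skew_at[of "?v x0" "?u' a"]
    by simp
qed

lemma d_contraction:
  fixes \<xi> \<eta>
  defines "u \<equiv> field c0 \<xi>" and "v \<equiv> field c0 \<eta>"
  shows "\<exists>\<beta>'. (\<forall>b. ((\<lambda>x. Im (\<Psi> c0 x (u x) (v x) b)) has_derivative (\<lambda>h. \<beta>' h b)) (at x0)) \<and>
    (\<forall>a b. \<beta>' a b - \<beta>' b a = -4 * (S c0 x0 (u x0) (v x0) * S c0 x0 a b - S c0 x0 (u x0) a * S c0 x0 (v x0) b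
      + S c0 x0 (u x0) b * S c0 x0 (v x0) a))"
proof -
  let ?u' = "field_deriv c0 \<xi> x0" and ?v' = "field_deriv c0 \<eta> x0"
  let ?Q = "\<lambda>a b d. Im (\<Psi> c0 x0 a b d)"
  define \<beta>' where "\<beta>' h b = dI c0 x0 h (u x0) (v x0) b + ?Q (?u' h) (v x0) b + ?Q (u x0) (?v' h) b" for h b
  have zero: "?Q a b 0 = 0" for a b
  proof -
    have "linear (?Q a b)" using Im_\<Psi>_trilinear[OF base(1,3)] unfolding trilinear_def by blast
    then show ?thesis by (rule linear_0)
  qed
  have "((\<lambda>x. Im (\<Psi> c0 x (u x) (v x) b)) has_derivative (\<lambda>h. \<beta>' h b)) (at x0)" for b
    unfolding \<beta>'_def u_def v_def
    using has_derivative_trilinear_family[OF eventually_cimg[OF base(1,3) Im_\<Psi>_trilinear[OF base(1)]]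
      I_has_derivative[OF base(1,3)] field_has_derivative[OF base(1,3), of \<xi>] field_has_derivative[OF base(1,3), of \<eta>]
      has_derivative_const[of b]] by (simp add: zero)
  moreover have "\<beta>' a b - \<beta>' b a = -4 * (S c0 x0 (u x0) (v x0) * S c0 x0 a b - S c0 x0 (u x0) a * S c0 x0 (v x0) b
      + S c0 x0 (u x0) b * S c0 x0 (v x0) a)" for a b
  proof -
    have skew: "?Q a' b' d = - ?Q b' a' d" "?Q b' d a' = - ?Q b' a' d" for a' b' d
      using arg_cong[OF \<Psi>_skew(1)[OF base(1,3)], of Im a' b' d]
        arg_cong[OF \<Psi>_skew(2)[OF base(1,3)], of Im b' d a']
      unfolding uminus_complex.simps .
    have "?Q (?u' a) (v x0) b = - ?Q (v x0) (?u' a) b" "?Q (u x0) (?v' b) a = - ?Q (u x0) a (?v' b)"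
      "?Q (?u' b) (v x0) a = - ?Q (v x0) (?u' b) a" "?Q (v x0) (?u' b) a = - ?Q (v x0) a (?u' b)"
      by (rule skew)+
    then show ?thesis
      using d\<psi>[of "u x0" "v x0" a b] lie_derivative_I[of \<xi> "v x0" a b] lie_derivative_I[of \<eta> "u x0" a b]
        generating_fields_commute[OF base(1,3), of \<xi> \<eta>]
      unfolding \<beta>'_def u_def v_def by simp
  qed
  ultimately show ?thesis by blast
qed

end

end

section \<open>The Laplacian of the multi-moment map\<close>

lemma length_6_eq:
  assumes "length E = 6"
  shows "E = [E ! 0, E ! 1, E ! 2, E ! 3, E ! 4, E ! 5]"
  by (rule nth_equalityI) (use assms in \<open>auto simp: less_Suc_eq numeral_eq_Suc\<close>)

lemma nths_singleton_index: "j < length E \<Longrightarrow> nths E {j} = [E ! j]"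
proof (induction E arbitrary: j)
  case (Cons a E)
  have "{i. Suc i \<in> {j}} = (if j = 0 then {} else {j - 1})" by auto
  then show ?case using Cons by (cases j) (auto simp: nths_Cons)
qed simp

lemma hodge_star_1:
  "hodge_star h E 1 \<beta> ws = (\<Sum>j<length E. \<beta> [E ! j] * frame_vol h E (E ! j # ws))"
proof -
  have I: "{I. I \<subseteq> {..<length E} \<and> card I = 1} = (\<lambda>j. {j}) ` {..<length E}"
    by (auto simp: card_1_singleton_iff)
  show ?thesis
    unfolding hodge_star_def I by (subst sum.reindex) (auto intro!: sum.cong simp: nths_singleton_index)
qed

lemma hodge_star_top:
  assumes "k = length E"
  shows "hodge_star h E k \<beta> [] = \<beta> E * frame_vol h E E"
proof -
  have "{I. I \<subseteq> {..<length E} \<and> card I = k} = {{..<length E}}"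
    using card_subset_eq[of "{..<length E}"] assms by auto
  moreover have "nths E {..<length E} = E" by (simp add: nths_upt_eq_take)
  ultimately show ?thesis by (simp add: hodge_star_def)
qed

context nearly_kaehler_torus
begin

context
  fixes c x E assumes c: "c \<in> A" and x: "x \<in> cimg c"
    and E: "su3_frame A g J \<psi> (cinv c x) E"
begin

lemma frame_length: "length E = 6" using E by (simp add: su3_frame_def)

lemma frame_vec: "i < 6 \<Longrightarrow> vec c x ((E ! i) c) = E ! i"
  using E frame_length by (intro vec_of_tangent[OF c x]) (auto simp: su3_frame_def)

lemma frame_G: "i < 6 \<Longrightarrow> g (cinv c x) (E ! i) (vec c x a) = G c x ((E ! i) c) a"
  by (simp add: G_def frame_vec)

lemma frame_hermitian: "hermitian_frame (G c x) (Jc c x) (\<lambda>i. (E ! i) c)"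
proof (rule hermitian_frame.intro)
  show "bilinear (G c x)" "linear (Jc c x)" by (rule G_bilinear[OF c x] Jc_linear[OF c x])+
  show "0 < G c x a a" if "a \<noteq> 0" for a using that by (rule G_pos[OF c x])
  show "Jc c x (Jc c x a) = - a" for a by (rule Jc_Jc[OF c x])
  show "G c x ((E ! i) c) ((E ! j) c) = (if i = j then 1 else 0)" if "i < 6" "j < 6" for i j
    using E that unfolding su3_frame_def orthonormal_list_def G_def by (simp add: frame_vec)
  show "Jc c x ((E ! (2 * k)) c) = (E ! (2 * k + 1)) c" if "k < 3" for k
    using E that unfolding su3_frame_def Jc_def by (simp add: frame_vec)
  show "G c x (Jc c x a) b = (\<Sum>k<3. G c x ((E ! (2 * k)) c) a * G c x ((E ! (2 * k + 1)) c) b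
      - G c x ((E ! (2 * k)) c) b * G c x ((E ! (2 * k + 1)) c) a)" for a b
  proof -
    have "fundamental_form g J (cinv c x) [vec c x a, vec c x b] =
      (\<Sum>k<3. wedge 1 1 (\<lambda>vs. g (cinv c x) (E ! (2 * k)) (vs ! 0)) (\<lambda>vs. g (cinv c x) (E ! (2 * k + 1)) (vs ! 0))
         [vec c x a, vec c x b])"
      using E vec_tangent[OF c x] unfolding su3_frame_def Let_def by blast
    then show ?thesis
      unfolding S_def[symmetric] S_eq[OF c x] wedge_1_1 by (simp add: frame_G)
  qed
qed

interpretation F: hermitian_frame "G c x" "Jc c x" "\<lambda>i. (E ! i) c" by (rule frame_hermitian)

lemma frame_\<sigma>: "F.\<sigma> = S c x"
  by (intro ext) (simp add: F.\<sigma>_def S_def)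

lemma frame_vol_eq:
  assumes "length vs = 6" "\<And>k. k < 6 \<Longrightarrow> vs ! k = vec c x (w k)"
  shows "frame_vol (g (cinv c x)) E vs = pfaffian6 (\<lambda>i j. S c x (w i) (w j))"
proof -
  have "frame_vol (g (cinv c x)) E vs =
    (\<Sum>\<pi> | \<pi> permutes {..<6}. of_int (sign \<pi>) * (\<Prod>i<6. G c x ((E ! i) c) (w (\<pi> i))))"
    unfolding frame_vol_def frame_length
  proof (intro sum.cong refl arg_cong2[where f="(*)"] prod.cong)
    fix \<pi> i assume "\<pi> \<in> {\<pi>. \<pi> permutes {..<6::nat}}" "i \<in> {..<6::nat}"
    then have "\<pi> i < 6" "i < 6" using permutes_in_image[of \<pi> "{..<6}" i] by auto
    then show "g (cinv c x) (E ! i) (vs ! \<pi> i) = G c x ((E ! i) c) (w (\<pi> i))"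
      by (simp add: assms(2) frame_G)
  qed
  then show ?thesis using F.det_eq_pfaffian6[of w] by (simp add: frame_\<sigma>)
qed

lemma frame_vol_self: "frame_vol (g (cinv c x)) E E = 1"
  using frame_vol_eq[of E "\<lambda>i. (E ! i) c"] F.pfaffian6_frame frame_length frame_vec by (simp add: frame_\<sigma>)

lemma hodge_star_1_frame:
  assumes \<beta>: "linear \<beta>" and \<alpha>: "\<And>a. \<alpha> [vec c x a] = 3 * \<beta> (Jc c x a)"
  shows "hodge_star (g (cinv c x)) E 1 \<alpha> (map (vec c x) [w 0, w 1, w 2, w 3, w 4]) =
    3 * pfaffian6 (\<lambda>i k. case i of 0 \<Rightarrow> \<beta> (w (k - 1)) | Suc i \<Rightarrow> S c x (w i) (w (k - 1)))"
proof -
  have "hodge_star (g (cinv c x)) E 1 \<alpha> (map (vec c x) [w 0, w 1, w 2, w 3, w 4]) =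
    (\<Sum>j<6. 3 * (\<beta> (Jc c x ((E ! j) c)) *
      pfaffian6 (\<lambda>i k. F.\<sigma> (case_nat ((E ! j) c) w i) (case_nat ((E ! j) c) w k))))"
    unfolding hodge_star_1 frame_length
  proof (rule sum.cong[OF refl])
    fix j assume "j \<in> {..<6::nat}"
    then have j: "j < 6" by simp
    have "frame_vol (g (cinv c x)) E (E ! j # map (vec c x) [w 0, w 1, w 2, w 3, w 4]) =
      pfaffian6 (\<lambda>i k. S c x (case_nat ((E ! j) c) w i) (case_nat ((E ! j) c) w k))"
    proof (rule frame_vol_eq)
      fix k :: nat assume "k < 6"
      from less_6_cases[OF this]
      show "(E ! j # map (vec c x) [w 0, w 1, w 2, w 3, w 4]) ! k = vec c x (case_nat ((E ! j) c) w k)"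
        by (elim insertE emptyE) (simp_all add: frame_vec[OF j])
    qed simp
    moreover have "\<alpha> [E ! j] = 3 * \<beta> (Jc c x ((E ! j) c))"
      using \<alpha>[of "(E ! j) c"] by (simp add: frame_vec[OF j])
    ultimately show "\<alpha> [E ! j] * frame_vol (g (cinv c x)) E (E ! j # map (vec c x) [w 0, w 1, w 2, w 3, w 4]) =
      3 * (\<beta> (Jc c x ((E ! j) c)) * pfaffian6 (\<lambda>i k. F.\<sigma> (case_nat ((E ! j) c) w i) (case_nat ((E ! j) c) w k)))"
      by (simp add: frame_\<sigma>)
  qed
  then show ?thesis
    unfolding sum_distrib_left[symmetric] F.contraction_of_pfaffian6[OF \<beta>] unfolding frame_\<sigma> .
qed

end

lemma some_frame:
  assumes "q \<in> topspace X"
  shows "su3_frame A g J \<psi> q (SOME E. su3_frame A g J \<psi> q E)"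
proof -
  have "\<exists>E. su3_frame A g J \<psi> q E" using su3 assms unfolding su3_structure_def by blast
  then show ?thesis by (rule someI_ex)
qed

context
  fixes \<xi> \<eta> :: "real \<times> real"
begin

abbreviation (input) "\<nu> \<equiv> multi_moment_map g J (generating_field A act \<xi>) (generating_field A act \<eta>)"

definition \<beta> :: "('m, real ^ 6) chart \<Rightarrow> real ^ 6 \<Rightarrow> real ^ 6 \<Rightarrow> real" where
  "\<beta> c x b = Im (\<Psi> c x (field c \<xi> x) (field c \<eta> x) b)"

lemma d\<nu>:
  assumes c: "c \<in> A" "x \<in> cimg c"
  shows "ext_deriv A (\<lambda>q _. \<nu> q) (cinv c x) [vec c x a] = 3 * \<beta> c x (Jc c x a)"
proof -
  let ?q = "cinv c x" and ?U = "\<lambda>\<xi>. generating_field A act \<xi> (cinv c x)"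
  note q = point[OF c]
  let ?d = "chart_at A ?q"
  note d = base[OF q(1)]
  have F: "vec e (cmap e ?q) (field e \<xi> (cmap e ?q)) = ?U \<xi>" if e: "e \<in> A" "?q \<in> cdom e" for e \<xi>
    using vec_of_tangent[OF e(1) cmap_in[OF e(2)], of "?U \<xi>"] generating_field_tangent[OF q(1), of \<xi>]
      generating_field_apply[OF e, of \<xi>] e by simp
  have V: "vec ?d (cmap ?d ?q) (vec c x a ?d) = vec c x a"
    using vec_of_tangent[OF d(1,3)] vec_tangent[OF c] d(4) by simp
  have "ext_deriv A (\<lambda>q _. \<nu> q) ?q [vec c x a] =
    3 * Re (\<Psi> ?d (cmap ?d ?q) (field ?d \<xi> (cmap ?d ?q)) (field ?d \<eta> (cmap ?d ?q)) (vec c x a ?d))"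
    unfolding ext_deriv_1[OF q(1)] d_multi_moment_map[OF q(1)] ..
  also have "\<dots> = 3 * Re (\<psi> ?q [?U \<xi>, ?U \<eta>, vec c x a])"
    unfolding \<Psi>_def F[OF d(1,2)] V d(4) ..
  also have "\<dots> = 3 * Re (\<Psi> c x (field c \<xi> x) (field c \<eta> x) a)"
    using F[OF c(1) q(2)] c by (simp add: \<Psi>_def)
  finally show ?thesis by (simp add: \<beta>_def \<Psi>_Jc'[OF c])
qed

lemma \<beta>_linear: "c \<in> A \<Longrightarrow> x \<in> cimg c \<Longrightarrow> linear (\<beta> c x)"
  using Im_\<Psi>_trilinear[of c x] unfolding \<beta>_def[abs_def] trilinear_def by blast

lemma star_d\<nu>:
  assumes c: "c \<in> A" "x \<in> cimg c"
  shows "form_in_chart A c (su3_star A g J \<psi> 1 (ext_deriv A (\<lambda>q _. \<nu> q))) x [e i0, e i1, e i2, e i3, e i4] =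
    3 * pfaffian5 (\<lambda>i. \<beta> c x (e i)) (pfaffian4 (\<lambda>i j. S c x (e i) (e j))) i0 i1 i2 i3 i4"
proof -
  let ?w = "\<lambda>k. e ([i0, i1, i2, i3, i4] ! k)"
  have "form_in_chart A c (su3_star A g J \<psi> 1 (ext_deriv A (\<lambda>q _. \<nu> q))) x [e i0, e i1, e i2, e i3, e i4] =
    hodge_star (g (cinv c x)) (SOME E. su3_frame A g J \<psi> (cinv c x) E) 1 (ext_deriv A (\<lambda>q _. \<nu> q) (cinv c x))
      (map (vec c x) [?w 0, ?w 1, ?w 2, ?w 3, ?w 4])"
    by (simp add: form_in_chart_def su3_star_def vec_def numeral_eq_Suc)
  also have "\<dots> = 3 * pfaffian6 (\<lambda>i k. case i of 0 \<Rightarrow> \<beta> c x (?w (k - 1)) | Suc i \<Rightarrow> S c x (?w i) (?w (k - 1)))"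
    by (rule hodge_star_1_frame[OF c some_frame[OF point(1)[OF c]] \<beta>_linear[OF c] d\<nu>[OF c]])
  also have "pfaffian6 (\<lambda>i k. case i of 0 \<Rightarrow> \<beta> c x (?w (k - 1)) | Suc i \<Rightarrow> S c x (?w i) (?w (k - 1))) =
    pfaffian5 (\<lambda>i. \<beta> c x (e i)) (pfaffian4 (\<lambda>i j. S c x (e i) (e j))) i0 i1 i2 i3 i4"
    by (simp add: pfaffian6_def pfaffian4_def pfaffian5_def numeral_eq_Suc)
  finally show ?thesis .
qed

lemma laplacian_\<nu>:
  assumes q: "q \<in> topspace X"
  shows "laplacian A g J \<psi> \<nu> q = 24 * \<nu> q"
proof -
  let ?c = "chart_at A q"
  let ?x = "cmap ?c q"
  note c = base(1)[OF q] base(3)[OF q] and q' = base(4)[OF q]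
  define E where "E = (SOME E. su3_frame A g J \<psi> q E)"
  have E: "su3_frame A g J \<psi> (cinv ?c ?x) E" unfolding E_def q' by (rule some_frame[OF q])
  interpret F: hermitian_frame "G ?c ?x" "Jc ?c ?x" "\<lambda>i. (E ! i) ?c" by (rule frame_hermitian[OF c E])
  define e where "e i = (E ! i) ?c" for i
  let ?f = "su3_star A g J \<psi> 1 (ext_deriv A (\<lambda>q _. \<nu> q))"
  let ?u = "field ?c \<xi> ?x" and ?v = "field ?c \<eta> ?x"
  let ?S = "S ?c ?x"
  have \<sigma>: "F.\<sigma> = ?S" by (rule frame_\<sigma>[OF c E])
  obtain \<beta>' where \<beta>': "\<And>b. ((\<lambda>x. \<beta> ?c x b) has_derivative (\<lambda>h. \<beta>' h b)) (at ?x)"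
    and d\<beta>: "\<And>a b. \<beta>' a b - \<beta>' b a = -4 * (?S ?u ?v * ?S a b - ?S ?u a * ?S ?v b + ?S ?u b * ?S ?v a)"
    using d_contraction[OF q, of \<xi> \<eta>] unfolding \<beta>_def by blast
  let ?s = "\<lambda>i j. ?S (e i) (e j)" and ?s' = "\<lambda>h i j. dS ?c ?x h (e i) (e j)"
  have D: "frechet_derivative (\<lambda>x. form_in_chart A ?c ?f x [e a, e b, e d, e k, e l]) (at ?x) h =
    3 * (pfaffian5 (\<lambda>i. \<beta>' h (e i)) (pfaffian4 ?s) a b d k l +
      pfaffian5 (\<lambda>i. \<beta> ?c ?x (e i)) (pfaffian4_deriv ?s (?s' h)) a b d k l)" for a b d k l h
  proof -
    have "((\<lambda>x. 3 * pfaffian5 (\<lambda>i. \<beta> ?c x (e i)) (pfaffian4 (\<lambda>i j. S ?c x (e i) (e j))) a b d k l) has_derivative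
      (\<lambda>h. 3 * (pfaffian5 (\<lambda>i. \<beta>' h (e i)) (pfaffian4 ?s) a b d k l +
      pfaffian5 (\<lambda>i. \<beta> ?c ?x (e i)) (pfaffian4_deriv ?s (?s' h)) a b d k l))) (at ?x)"
      by (intro has_derivative_mult_right has_derivative_pfaffian5 \<beta>' S_has_derivative c)
    then have "((\<lambda>x. form_in_chart A ?c ?f x [e a, e b, e d, e k, e l]) has_derivative
      (\<lambda>h. 3 * (pfaffian5 (\<lambda>i. \<beta>' h (e i)) (pfaffian4 ?s) a b d k l +
      pfaffian5 (\<lambda>i. \<beta> ?c ?x (e i)) (pfaffian4_deriv ?s (?s' h)) a b d k l))) (at ?x)"
      by (rule has_derivative_transform_within_open[OF _ cimg_open[OF c(1)] c(2)]) (simp only: star_d\<nu>[OF c(1)])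
    from fun_cong[OF frechet_derivative_at[OF this], of h] show ?thesis by simp
  qed
  let ?D = "\<lambda>i. pfaffian5 (\<lambda>j. \<beta>' (e i) (e j)) (pfaffian4 ?s)"
    and ?D' = "\<lambda>i. pfaffian5 (\<lambda>j. \<beta> ?c ?x (e j)) (pfaffian4_deriv ?s (?s' (e i)))"
  have list: "E = [E ! 0, E ! 1, E ! 2, E ! 3, E ! 4, E ! 5]"
    by (rule length_6_eq[OF frame_length[OF c E]])
  have "ext_deriv A ?f q E = ext_deriv A ?f q [E ! 0, E ! 1, E ! 2, E ! 3, E ! 4, E ! 5]"
    using list by simp
  also have "\<dots> = 3 * (?D 0 1 2 3 4 5 + ?D' 0 1 2 3 4 5) - 3 * (?D 1 0 2 3 4 5 + ?D' 1 0 2 3 4 5)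
      + 3 * (?D 2 0 1 3 4 5 + ?D' 2 0 1 3 4 5) - 3 * (?D 3 0 1 2 4 5 + ?D' 3 0 1 2 4 5)
      + 3 * (?D 4 0 1 2 3 5 + ?D' 4 0 1 2 3 5) - 3 * (?D 5 0 1 2 3 4 + ?D' 5 0 1 2 3 4)"
    unfolding D[symmetric] by (simp add: ext_deriv_def Let_def e_def eval_nat_numeral)
  also have "\<dots> = 3 * (?D 0 1 2 3 4 5 + ?D' 0 1 2 3 4 5 - (?D 1 0 2 3 4 5 + ?D' 1 0 2 3 4 5)
      + (?D 2 0 1 3 4 5 + ?D' 2 0 1 3 4 5) - (?D 3 0 1 2 4 5 + ?D' 3 0 1 2 4 5)
      + (?D 4 0 1 2 3 5 + ?D' 4 0 1 2 3 5) - (?D 5 0 1 2 3 4 + ?D' 5 0 1 2 3 4))"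
    by (simp add: algebra_simps)
  also have "\<dots> = 3 * (\<Sum>j<3. \<beta>' (e (2 * j)) (e (2 * j + 1)) - \<beta>' (e (2 * j + 1)) (e (2 * j)))"
  proof (subst exterior_derivative_of_pfaffian5)
    fix a b d assume abd: "(a, b, d) \<in> {(0, Suc 0, 2), (0, Suc 0, 3), (0, Suc 0, 4), (0, Suc 0, 5), (0, 2, 3), (Suc 0, 2, 3),
      (2, 3, 4), (2, 3, 5), (0, 4, 5), (Suc 0, 4, 5), (2, 4, 5), (3, 4, 5::nat)}"
    have J: "e (Suc 0) = Jc ?c ?x (e 0)" "e 3 = Jc ?c ?x (e 2)" "e 5 = Jc ?c ?x (e 4)"
      using F.J_e_values by (simp_all add: e_def)
    have "\<Psi> ?c ?x (e a) (e b) (e d) = 0"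
      using abd by (auto simp: J \<Psi>_Jc_self[OF c])
    then show "dS ?c ?x (e a) (e b) (e d) - dS ?c ?x (e b) (e a) (e d) + dS ?c ?x (e d) (e a) (e b) = 0"
      using d\<sigma>[OF q, of "e a" "e b" "e d"] by simp
  qed (simp_all add: \<sigma>[symmetric] e_def F.\<sigma>_e_left F.ortho)
  also have "\<dots> = 3 * (-4 * (2 * ?S ?u ?v))"
    using F.\<sigma>_square_contraction[of ?u ?v] unfolding d\<beta> sum_distrib_left[symmetric] \<sigma> e_def by (simp only:)
  finally have "ext_deriv A ?f q E = - 24 * ?S ?u ?v" by simp
  moreover have "\<nu> q = ?S ?u ?v"
    using multi_moment_map_chart[OF q c(2)] q' by simp
  moreover have "laplacian A g J \<psi> \<nu> q = - ext_deriv A ?f q E"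
    using frame_vol_self[OF c E] frame_length[OF c E]
    by (simp add: laplacian_def su3_star_def[of _ _ _ _ 6] E_def[symmetric] hodge_star_top q')
  ultimately show ?thesis by simp
qed

end

end

theorem lemma3p1:
  fixes X :: "'m topology"
    and A :: "('m, real ^ 6) chart set"
    and g :: "'m \<Rightarrow> ('m, real ^ 6) tangent \<Rightarrow> ('m, real ^ 6) tangent \<Rightarrow> real"
    and J :: "'m \<Rightarrow> ('m, real ^ 6) tangent \<Rightarrow> ('m, real ^ 6) tangent"
    and \<psi> :: "('m, real ^ 6, complex) form"
    and act :: "complex \<times> complex \<Rightarrow> 'm \<Rightarrow> 'm"
    and \<xi> \<eta> :: "real \<times> real"
    and U V :: "'m \<Rightarrow> ('m, real ^ 6) tangent"
    and \<nu> :: "'m \<Rightarrow> real"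
  assumes "smooth_manifold X A" "compact_space X" "connected_space X"
    and "nearly_kaehler X A g J \<psi>"
    and "smooth_torus_action X A act" "effective_torus_action X act"
    and "preserves_su3_structure X A g J \<psi> act"
    and "\<xi> \<noteq> \<eta>" "independent {\<xi>, \<eta>}" "span {\<xi>, \<eta>} = UNIV"
    and "U = generating_field A act \<xi>" "V = generating_field A act \<eta>"
    and "\<nu> = multi_moment_map g J U V"
  shows "\<forall>p\<in>topspace X. laplacian A g J \<psi> \<nu> p = 24 * \<nu> p"
proof -
  interpret nearly_kaehler_torus X A act g J \<psi>
    using assms by unfold_locales
  show ?thesis using laplacian_\<nu> assms by blast
qed

end
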